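(* Let $2<p<\infty$. Then $L_p[0,1]$ has an equivalent norm given by partitions and weights (with exponent $p$).
   Context: Scalars are real and $L_p[0,1]$ is taken with respect to Lebesgue measure. Fix $2<p<\infty$. For a partition $P=\{N_i\}$ of $\mathbb{N}$ and a weight function $W=(w_j)_{j\in\mathbb{N}}:\mathbb{N}\to(0,1]$, define for a real sequence $(a_i)$ $$\|(a_i)\|_{P,W}=\left(\sum_i\left(\sum_{j\in N_i}a_j^2w_j^2\right)^{p/2}\right)^{1/p}.$$ For a nonempty family $\mathcal{P}=(P_k,W_k)_{k\in K}$ of pairs consisting of a partition $P_k$ of $\mathbb{N}$ and a weight function $W_k:\mathbb{N}\to(0,1]$, define $$\|(a_i)\|_{\mathcal{P}}=\sup_{k\in K}\|(a_i)\|_{P_k,W_k}.$$ This is called a norm determined (or given) by partitions and weights. To say that an infinite-dimensional Banach space $X$ has an equivalent norm given by partitions and weights (with exponent $p$) means that there are a Schauder basis $(x_n)_{n\in\mathbb{N}}$ of $X$, a nonempty family $\mathcal{P}=(P_k,W_k)_{k\in K}$ of pairs consisting of a partition $P_k$ of $\mathbb{N}$ and a weight function $W_k:\mathbb{N}\to(0,1]$, and constants $0<c\le C<\infty$ such that $$c\left\|\sum_n a_nx_n\right\|_X\le\|(a_n)\|_{\mathcal{P}}\le C\left\|\sum_n a_nx_n\right\|_X$$ for every $\sum_n a_nx_n\in X$; that is, $|||\sum_n a_nx_n|||=\|(a_n)\|_{\mathcal{P}}$ defines an equivalent norm on $X$. *)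

theory Defs
  imports "HOL-Analysis.Analysis"
begin

section \<open>The spaces \<open>L\<^sub>p[0,1]\<close>\<close>

abbreviation unit_leb :: "real measure" where
  "unit_leb \<equiv> lebesgue_on {0..1}"

text \<open>Classes modulo almost everywhere equality of real Lebesgue measurable functions on \<open>[0,1]\<close>.
  Representatives are total functions on the reals whose values outside \<open>[0,1]\<close> are irrelevant.\<close>

definition ae_equal :: "(real \<Rightarrow> real) \<Rightarrow> (real \<Rightarrow> real) \<Rightarrow> bool" where
  "ae_equal f g \<longleftrightarrow> f \<in> borel_measurable unit_leb \<and> g \<in> borel_measurable unit_leb
     \<and> (AE x in unit_leb. f x = g x)"

quotient_type mclass = "real \<Rightarrow> real" / partial: ae_equal
proof (rule part_equivpI)
  show "\<exists>f. ae_equal f f"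
    by (rule exI[of _ "\<lambda>_. 0"]) (simp add: ae_equal_def)
  show "symp ae_equal"
    by (auto simp: symp_def ae_equal_def)
  show "transp ae_equal"
    by (auto simp: transp_def ae_equal_def)
qed

instantiation mclass :: real_vector
begin

lift_definition zero_mclass :: mclass is "\<lambda>_. 0"
  by (simp add: ae_equal_def)

lift_definition plus_mclass :: "mclass \<Rightarrow> mclass \<Rightarrow> mclass" is "\<lambda>f g x. f x + g x"
  by (auto simp: ae_equal_def)

lift_definition minus_mclass :: "mclass \<Rightarrow> mclass \<Rightarrow> mclass" is "\<lambda>f g x. f x - g x"
  by (auto simp: ae_equal_def)

lift_definition uminus_mclass :: "mclass \<Rightarrow> mclass" is "\<lambda>f x. - f x"
  by (auto simp: ae_equal_def)

lift_definition scaleR_mclass :: "real \<Rightarrow> mclass \<Rightarrow> mclass" is "\<lambda>c f x. c * f x"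
  by (auto simp: ae_equal_def)

instance
  by standard (transfer, auto simp: ae_equal_def algebra_simps)+

end

lift_definition in_Lp :: "real \<Rightarrow> mclass \<Rightarrow> bool" is
  "\<lambda>p f. integrable unit_leb (\<lambda>x. \<bar>f x\<bar> powr p)"
proof -
  fix p :: real and f g :: "real \<Rightarrow> real"
  assume "ae_equal f g"
  then have [measurable]: "f \<in> borel_measurable unit_leb" "g \<in> borel_measurable unit_leb"
    and "AE x in unit_leb. f x = g x"
    by (simp_all add: ae_equal_def)
  then show "integrable unit_leb (\<lambda>x. \<bar>f x\<bar> powr p) = integrable unit_leb (\<lambda>x. \<bar>g x\<bar> powr p)"
    by (intro integrable_cong_AE) auto
qed

definition Lp :: "real \<Rightarrow> mclass set" where
  "Lp p = {u. in_Lp p u}"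

lift_definition Lp_norm :: "real \<Rightarrow> mclass \<Rightarrow> real" is
  "\<lambda>p f. (LINT x|unit_leb. \<bar>f x\<bar> powr p) powr (1 / p)"
proof -
  fix p :: real and f g :: "real \<Rightarrow> real"
  assume "ae_equal f g"
  then have [measurable]: "f \<in> borel_measurable unit_leb" "g \<in> borel_measurable unit_leb"
    and "AE x in unit_leb. f x = g x"
    by (simp_all add: ae_equal_def)
  then have "(LINT x|unit_leb. \<bar>f x\<bar> powr p) = (LINT x|unit_leb. \<bar>g x\<bar> powr p)"
    by (intro integral_cong_AE) auto
  then show "(LINT x|unit_leb. \<bar>f x\<bar> powr p) powr (1 / p)
      = (LINT x|unit_leb. \<bar>g x\<bar> powr p) powr (1 / p)"
    by simp
qed

section \<open>Schauder bases\<close>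

text \<open>A normed space is given by a linear subspace \<open>V\<close> of a real vector space together with
  a norm \<open>N\<close>, of which only the values on \<open>V\<close> matter.\<close>

definition expansion :: "('a::real_vector \<Rightarrow> real) \<Rightarrow> (nat \<Rightarrow> 'a) \<Rightarrow> (nat \<Rightarrow> real) \<Rightarrow> 'a \<Rightarrow> bool" where
  "expansion N x a u \<longleftrightarrow> (\<lambda>m. N (u - (\<Sum>n<m. a n *\<^sub>R x n))) \<longlonglongrightarrow> 0"

definition schauder_basis :: "'a::real_vector set \<Rightarrow> ('a \<Rightarrow> real) \<Rightarrow> (nat \<Rightarrow> 'a) \<Rightarrow> bool" where
  "schauder_basis V N x \<longleftrightarrow> range x \<subseteq> V \<and> (\<forall>u\<in>V. \<exists>!a. expansion N x a u)"

section \<open>Norms given by partitions and weights\<close>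

text \<open>The \<open>r\<close>-th power on \<open>[0,\<infinity>]\<close>, meant for \<open>r > 0\<close>.\<close>

definition epowr :: "ennreal \<Rightarrow> real \<Rightarrow> ennreal" where
  "epowr t r = (if t = \<infinity> then \<infinity> else ennreal (enn2real t powr r))"

text \<open>The norms below are evaluated at arbitrary real sequences, hence take values in \<open>[0,\<infinity>]\<close>.\<close>

definition pw_norm1 :: "real \<Rightarrow> nat set set \<Rightarrow> (nat \<Rightarrow> real) \<Rightarrow> (nat \<Rightarrow> real) \<Rightarrow> ennreal" where
  "pw_norm1 p P W a =
     epowr (\<Sum>\<^sub>\<infinity>B\<in>P. epowr (\<Sum>\<^sub>\<infinity>j\<in>B. ennreal ((a j)\<^sup>2 * (W j)\<^sup>2)) (p / 2)) (1 / p)"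

definition pw_family :: "(nat set set \<times> (nat \<Rightarrow> real)) set \<Rightarrow> bool" where
  "pw_family F \<longleftrightarrow> F \<noteq> {} \<and>
     (\<forall>(P, W)\<in>F. partition_on UNIV P \<and> (\<forall>j. 0 < W j \<and> W j \<le> 1))"

definition pw_norm :: "real \<Rightarrow> (nat set set \<times> (nat \<Rightarrow> real)) set \<Rightarrow> (nat \<Rightarrow> real) \<Rightarrow> ennreal" where
  "pw_norm p F a = (SUP (P, W)\<in>F. pw_norm1 p P W a)"

definition has_equivalent_pw_norm :: "real \<Rightarrow> 'a::real_vector set \<Rightarrow> ('a \<Rightarrow> real) \<Rightarrow> bool" where
  "has_equivalent_pw_norm p V N \<longleftrightarrow>
     (\<exists>x F c C. schauder_basis V N x \<and> pw_family F \<and> 0 < c \<and> c \<le> C \<and>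
        (\<forall>u\<in>V. \<forall>a. expansion N x a u \<longrightarrow>
           ennreal (c * N u) \<le> pw_norm p F a \<and> pw_norm p F a \<le> ennreal (C * N u)))"

end

theory Submission
  imports Defs "HOL-Library.Discrete_Functions"
begin

text \<open>
  The basis is the Haar system \<open>(h\<^sub>n)\<close>, and every partition in the family is the trivial one
  with the single block of all natural numbers; only the weights vary.

  For \<open>f = \<Sum> a\<^sub>n h\<^sub>n\<close> let \<open>S = \<Sum> a\<^sub>n\<^sup>2 h\<^sub>n\<^sup>2\<close> be the square of the square function. The
  Littlewood--Paley theorem for the Haar system says that the \<open>L\<^sub>p\<close> norm of \<open>f\<close> is comparable to
  that of \<open>S\<^sup>1\<^sup>/\<^sup>2\<close>, that is, to the square root of the norm of \<open>S\<close> in \<open>L\<^sub>r\<close> with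
  \<open>r = p/2 > 1\<close>. As \<open>S\<close> is nonnegative, duality of \<open>L\<^sub>r\<close> and \<open>L\<^sub>q\<close> presents this norm as a
  supremum over positive \<open>g\<close> in the unit ball of \<open>L\<^sub>q\<close> of
  \<open>\<integral> S g = \<Sum> a\<^sub>n\<^sup>2 w\<^sub>n\<^sup>2\<close>, where \<open>w\<^sub>n\<^sup>2 = \<integral> h\<^sub>n\<^sup>2 g\<close>. For a single block the inner
  and the outer exponent cancel, so the square roots of these sums are exactly the norms
  given by the weights \<open>w\<close>. Here \<open>p > 2\<close> enters: it makes \<open>r > 1\<close>, so that a dual
  exponent is available.

  The square function estimates are proved by Bellman functions. Let \<open>f\<^sub>m\<close> and \<open>s\<^sub>m\<close> be the
  partial sums of \<open>f\<close> and \<open>S\<close>. Both are constant on the support of the next Haar function, so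
  passing to \<open>m + 1\<close> replaces \<open>(c, s)\<close> by \<open>(c + a, s + a\<^sup>2)\<close> and \<open>(c - a, s + a\<^sup>2)\<close> on two halves
  of equal measure. Hence \<open>\<integral> F(f\<^sub>m, s\<^sub>m)\<close> decreases in \<open>m\<close> whenever the mean of \<open>F\<close> at these two
  points is at most \<open>F c s\<close> (lemma \<open>integral_haar_supersolution_step\<close>). Two such functions,
  \<open>s\<^sup>r - r f\<^sup>2 s\<^sup>r\<^sup>-\<^sup>1\<close> and \<open>u\<^sup>r - C u\<^sup>r\<^sup>-\<^sup>1 s - C s\<^sup>r\<close> with \<open>u = f\<^sup>2 + s\<close>, give the two estimates
  after the mixed terms have been absorbed pointwise (lemma
  \<open>haar_square_function_equivalence\<close>).

  Since \<open>S\<close> grows with the number of terms, the equivalence also bounds the partial sums of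
  Haar series uniformly in \<open>L\<^sub>p\<close>. Together with the density of Haar sums this makes the Haar
  system a Schauder basis.

  Estimates in \<open>L\<^sub>p\<close> are phrased through the modular \<open>\<integral> \<bar>f\<bar>\<^sup>p\<close>, the \<open>p\<close>-th power of the norm.
  Constants are irrelevant throughout, so the crude inequality
  \<open>\<integral> \<bar>f + g\<bar>\<^sup>p \<le> 2\<^sup>p (\<integral> \<bar>f\<bar>\<^sup>p + \<integral> \<bar>g\<bar>\<^sup>p)\<close> replaces the triangle inequality.
\<close>

section \<open>Inequalities for real powers\<close>

text \<open>The graph of \<open>y \<mapsto> y\<^sup>r\<close> lies above its tangent at \<open>x\<close>; this is Young's inequality for
  \<open>y\<close> and \<open>x\<^sup>r\<^sup>-\<^sup>1\<close>. The left-hand side is linear in \<open>y\<close>, so the inequality can be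
  integrated for fixed \<open>x\<close>.\<close>

lemma powr_tangent:
  fixes x y r :: real
  assumes "1 < r" "0 \<le> x" "0 \<le> y"
  shows "r * x powr (r - 1) * y \<le> y powr r + (r - 1) * x powr r"
proof -
  have "y * x powr (r-1) \<le> y powr r / r + (x powr (r-1)) powr (r/(r-1)) / (r/(r-1))"
    using assms by (intro Youngs_inequality) (auto simp: field_simps)
  also have "(x powr (r-1)) powr (r/(r-1)) = x powr r"
    using assms by (simp add: powr_powr)
  finally have "r * (y * x powr (r-1)) \<le> r * (y powr r / r + x powr r / (r/(r-1)))"
    using assms by (intro mult_left_mono) auto
  also have "\<dots> = y powr r + (r - 1) * x powr r"
    using assms by (simp add: distrib_left)
  finally show ?thesis by (simp add: mult_ac)
qed

lemma mult_powr_diff_one: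
  fixes x r :: real
  assumes "0 \<le> x"
  shows "x * x powr (r - 1) = x powr r"
  using assms by (simp add: powr_mult_base)

lemma powr_diff_le:
  fixes x y r :: real
  assumes "1 < r" "0 \<le> x" "0 \<le> y"
  shows "x powr r - y powr r \<le> r * x powr (r - 1) * (x - y)"
  using powr_tangent[OF assms] mult_powr_diff_one[of x r] assms by (simp add: algebra_simps)

lemma powr_add_superadditive:
  fixes x y r :: real
  assumes "1 < r" "0 \<le> x" "0 \<le> y"
  shows "x powr r + y powr r \<le> (x + y) powr r"
proof -
  have "x * x powr (r-1) + y * y powr (r-1) \<le> x * (x+y) powr (r-1) + y * (x+y) powr (r-1)"
    using assms by (intro add_mono mult_left_mono powr_mono2) auto
  also have "\<dots> = (x+y) * (x+y) powr (r-1)" by (simp add: algebra_simps)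
  finally show ?thesis using assms by (simp add: mult_powr_diff_one)
qed

lemma powr_add_le:
  fixes x y r :: real
  assumes "0 \<le> r" "0 \<le> x" "0 \<le> y"
  shows "(x + y) powr r \<le> 2 powr r * (x powr r + y powr r)"
proof -
  have "(x + y) powr r \<le> (2 * max x y) powr r"
    using assms by (intro powr_mono2) auto
  also have "\<dots> = 2 powr r * max (x powr r) (y powr r)"
    using assms powr_mono2[of r x y] powr_mono2[of r y x] by (auto simp: powr_mult max_def)
  also have "\<dots> \<le> 2 powr r * (x powr r + y powr r)"
    by (intro mult_left_mono) auto
  finally show ?thesis .
qed

lemma powr_symmetric_gap:
  fixes x b :: real
  assumes "0 < b" "0 \<le> x" "x \<le> 1"
  shows "(1 + x) powr b - (1 - x) powr b \<le> (2 + 2 * b * 2 powr b) * x"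
proof (cases "b \<le> 1")
  case True
  have "(1 + x) powr b \<le> (1 + x) powr 1"
    using assms True by (intro powr_mono) auto
  moreover have "(1 - x) powr 1 \<le> (1 - x) powr b"
    using assms True by (intro powr_mono') auto
  ultimately have "(1 + x) powr b - (1 - x) powr b \<le> 2 * x" using assms by simp
  also have "\<dots> \<le> (2 + 2 * b * 2 powr b) * x" using assms by (intro mult_right_mono) auto
  finally show ?thesis .
next
  case False
  have "(1 + x) powr b - (1 - x) powr b \<le> b * (1 + x) powr (b - 1) * ((1 + x) - (1 - x))"
    using assms False by (intro powr_diff_le) auto
  also have "\<dots> \<le> b * 2 powr b * (2 * x)"
  proof (intro mult_mono)
    have "(1 + x) powr (b - 1) \<le> (1 + x) powr b" using assms by (intro powr_mono) auto
    also have "\<dots> \<le> 2 powr b" using assms by (intro powr_mono2) auto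
    finally show "(1 + x) powr (b - 1) \<le> 2 powr b" .
  qed (use assms in auto)
  also have "\<dots> \<le> (2 + 2 * b * 2 powr b) * x" using assms by (simp add: algebra_simps)
  finally show ?thesis .
qed

text \<open>The symmetric second difference of \<open>v\<^sup>r\<close> is of order \<open>v\<^sup>r\<^sup>-\<^sup>2 t\<^sup>2\<close>. This exponent is negative for
  \<open>r < 2\<close>, so the estimate is phrased with a bound \<open>4 v \<delta>\<close> for \<open>t\<^sup>2\<close>, which leaves the harmless
  power \<open>v\<^sup>r\<^sup>-\<^sup>1\<close>. After scaling to \<open>v = 1\<close>, the tangent inequality at both end points reduces
  the claim to the first-order gap above.\<close>

lemma powr_second_difference:
  fixes v t \<delta> r :: real
  assumes r: "1 < r" and "0 \<le> t" "t \<le> v" "t\<^sup>2 \<le> 4 * v * \<delta>" "0 \<le> \<delta>"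
  defines "K \<equiv> r * (2 + 2 * (r - 1) * 2 powr (r - 1))"
  shows "(v + t) powr r + (v - t) powr r \<le> 2 * v powr r + 4 * K * v powr (r - 1) * \<delta>"
proof (cases "v = 0")
  case True then show ?thesis using assms by simp
next
  case False
  then have v: "v > 0" using assms by auto
  define x where "x = t / v"
  have x: "0 \<le> x" "x \<le> 1" and t: "t = v * x" using assms v by (auto simp: x_def field_simps)
  have 1: "(1 + x) powr r - 1 powr r \<le> r * (1 + x) powr (r - 1) * (1 + x - 1)"
    using x r by (intro powr_diff_le) auto
  have 2: "(1 - x) powr r - 1 powr r \<le> r * (1 - x) powr (r - 1) * (1 - x - 1)"
    using x r by (intro powr_diff_le) auto
  have "(1 + x) powr r + (1 - x) powr r - 2
      \<le> r * x * ((1 + x) powr (r - 1) - (1 - x) powr (r - 1))"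
    using 1 2 by (simp add: algebra_simps)
  also have "\<dots> \<le> r * x * ((2 + 2 * (r - 1) * 2 powr (r - 1)) * x)"
    using x r by (intro mult_left_mono powr_symmetric_gap) auto
  finally have *: "(1 + x) powr r + (1 - x) powr r - 2 \<le> K * x\<^sup>2"
    by (simp add: K_def power2_eq_square algebra_simps)
  have K: "0 \<le> K" using r by (auto simp: K_def)
  have "v * (v * x\<^sup>2) \<le> v * (4 * \<delta>)"
    using assms by (simp add: t power_mult_distrib power2_eq_square mult_ac)
  then have vx: "v * x\<^sup>2 \<le> 4 * \<delta>" using v by (simp only: mult_le_cancel_left_pos)
  have "(v + t) powr r + (v - t) powr r - 2 * v powr r
      = (v * (1 + x)) powr r + (v * (1 - x)) powr r - 2 * v powr r"
    by (simp add: t algebra_simps)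
  also have "\<dots> = v powr r * ((1 + x) powr r + (1 - x) powr r - 2)"
    by (simp only: powr_mult) (simp add: algebra_simps)
  also have "\<dots> \<le> v powr r * (K * x\<^sup>2)"
    using * by (intro mult_left_mono) auto
  also have "\<dots> = K * v powr (r - 1) * (v * x\<^sup>2)"
    using mult_powr_diff_one[of v r] v by (simp add: mult_ac)
  also have "\<dots> \<le> K * v powr (r - 1) * (4 * \<delta>)"
    using vx K by (intro mult_left_mono) auto
  finally show ?thesis by simp
qed

text \<open>If \<open>u = c\<^sup>2 + s\<close>, a Haar step turns \<open>u\<close> into one of the two values
  \<open>u + 2 d\<^sup>2 \<plusminus> 2 c d\<close>. The first-order terms \<open>\<plusminus> 2 c d\<close> cancel in the mean, and what remains
  is of second order in \<open>d\<close> because \<open>c\<^sup>2 \<le> u\<close>.\<close>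

lemma powr_symmetric_increment:
  fixes r :: real
  assumes r: "1 < r"
  obtains C where "1 \<le> C" "\<And>u f d. f\<^sup>2 \<le> u \<Longrightarrow>
     (u + 2 * d\<^sup>2 + 2 * f * d) powr r + (u + 2 * d\<^sup>2 - 2 * f * d) powr r
     \<le> 2 * u powr r + 2 * C * (u powr (r - 1) * d\<^sup>2 + (d\<^sup>2) powr r)"
proof
  define K where "K = r * (2 + 2 * (r - 1) * 2 powr (r - 1))"
  define C where "C = (2 * r + 2 * K) * 4 powr (r - 1)"
  have K: "0 \<le> K" using r by (auto simp: K_def)
  have "1 * 1 \<le> (2 * r + 2 * K) * 4 powr (r - 1)"
    using K r by (intro mult_mono ge_one_powr_ge_zero) auto
  then show "1 \<le> C" by (simp add: C_def)
  fix u f d :: real assume u: "f\<^sup>2 \<le> u"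
  define v t where "v = u + 2 * d\<^sup>2" and "t = \<bar>2 * f * d\<bar>"
  have u0: "0 \<le> u" using u by (meson order_trans zero_le_power2)
  have "0 \<le> (\<bar>f\<bar> - \<bar>d\<bar>)\<^sup>2" by simp
  then have "2 * (\<bar>f\<bar> * \<bar>d\<bar>) \<le> f\<^sup>2 + d\<^sup>2" by (simp add: power2_diff)
  then have tv: "t \<le> v" using u zero_le_power2[of d] unfolding t_def v_def abs_mult by linarith
  have "f\<^sup>2 \<le> v" using u zero_le_power2[of d] unfolding v_def by linarith
  then have "f\<^sup>2 * d\<^sup>2 \<le> v * d\<^sup>2" by (intro mult_right_mono) auto
  then have t2: "t\<^sup>2 \<le> 4 * v * d\<^sup>2" by (simp add: t_def power_mult_distrib)
  have "(u + 2 * d\<^sup>2 + 2 * f * d) powr r + (u + 2 * d\<^sup>2 - 2 * f * d) powr r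
      = (v + t) powr r + (v - t) powr r"
    by (auto simp: v_def t_def abs_real_def)
  also have "\<dots> \<le> 2 * v powr r + 4 * K * v powr (r - 1) * d\<^sup>2"
    unfolding K_def using r t2 tv by (intro powr_second_difference) (auto simp: t_def)
  also have "v powr r \<le> u powr r + r * v powr (r - 1) * (2 * d\<^sup>2)"
    using powr_diff_le[of r v u] r u0 by (simp add: v_def)
  finally have "(u + 2 * d\<^sup>2 + 2 * f * d) powr r + (u + 2 * d\<^sup>2 - 2 * f * d) powr r
      \<le> 2 * u powr r + (4 * r + 4 * K) * (v powr (r - 1) * d\<^sup>2)"
    by (simp add: algebra_simps)
  also have "v powr (r - 1) \<le> 2 powr (r - 1) * (u powr (r - 1) + (2 * d\<^sup>2) powr (r - 1))"
    unfolding v_def using r u0 by (intro powr_add_le) auto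
  also have "\<dots> \<le> 2 powr (r - 1) * (2 powr (r - 1) * u powr (r - 1) + (2 * d\<^sup>2) powr (r - 1))"
    using r ge_one_powr_ge_zero[of 2 "r - 1"] by (intro mult_left_mono add_mono) (auto simp: mult_le_cancel_right1)
  also have "\<dots> = 4 powr (r - 1) * (u powr (r - 1) + (d\<^sup>2) powr (r - 1))"
    using powr_mult[of 2 2 "r - 1"] by (simp add: powr_mult algebra_simps)
  finally have "(u + 2 * d\<^sup>2 + 2 * f * d) powr r + (u + 2 * d\<^sup>2 - 2 * f * d) powr r
    \<le> 2 * u powr r + (4 * r + 4 * K) * (4 powr (r - 1) * (u powr (r - 1) + (d\<^sup>2) powr (r - 1)) * d\<^sup>2)"
    using r K by (simp add: mult_left_mono mult_right_mono)
  also have "\<dots> = 2 * u powr r + 2 * C * (u powr (r - 1) * d\<^sup>2 + d\<^sup>2 * (d\<^sup>2) powr (r - 1))"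
    by (simp add: C_def algebra_simps)
  finally show "(u + 2 * d\<^sup>2 + 2 * f * d) powr r + (u + 2 * d\<^sup>2 - 2 * f * d) powr r
     \<le> 2 * u powr r + 2 * C * (u powr (r - 1) * d\<^sup>2 + (d\<^sup>2) powr r)"
    by (simp add: mult_powr_diff_one)
qed

text \<open>By the inequality of arithmetic and geometric means, a lower bound for a product passes to the
  mean of any power. Applied to the two values of \<open>f\<^sup>2 + s\<close> after a Haar step, it shows that
  \<open>(f\<^sup>2 + s)\<^sup>b\<close> increases in the mean for every \<open>b \<ge> 0\<close>, even for \<open>b < 1/2\<close>, where
  \<open>\<bar>f\<bar>\<^sup>2\<^sup>b\<close> alone is not convex.\<close>

lemma powr_product_mean:
  fixes x y u b :: real
  assumes "0 \<le> b" "0 \<le> x" "0 \<le> y" "0 \<le> u" "u\<^sup>2 \<le> x * y"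
  shows "2 * u powr b \<le> x powr b + y powr b"
proof (rule power2_le_imp_le)
  have "(u powr b)\<^sup>2 = (u\<^sup>2) powr b" using assms by (simp add: power2_eq_square powr_mult)
  also have "\<dots> \<le> (x * y) powr b" using assms by (intro powr_mono2) auto
  finally have "(u powr b)\<^sup>2 \<le> x powr b * y powr b" by (simp add: powr_mult)
  moreover have "0 \<le> (x powr b - y powr b)\<^sup>2" by simp
  ultimately show "(2 * u powr b)\<^sup>2 \<le> (x powr b + y powr b)\<^sup>2"
    by (simp add: power2_eq_square algebra_simps)
qed simp

text \<open>The mixed term is absorbed into the two pure powers: into the first if \<open>s \<le> e u\<close>, into the
  second otherwise.\<close>

lemma powr_split_small:
  fixes u s r e :: real
  assumes "1 < r" "0 < e" "0 \<le> s" "0 \<le> u"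
  shows "u powr (r - 1) * s \<le> e * u powr r + e powr (1 - r) * s powr r"
proof (cases "s \<le> e * u")
  case True
  then have "u powr (r - 1) * s \<le> u powr (r - 1) * (e * u)" by (intro mult_left_mono) auto
  also have "\<dots> = e * u powr r" using mult_powr_diff_one[of u r] assms by (simp add: algebra_simps)
  finally show ?thesis by (simp add: add_increasing2)
next
  case False
  then have "u \<le> s / e" using assms by (simp add: field_simps)
  then have "u powr (r - 1) * s \<le> (s / e) powr (r - 1) * s"
    using assms by (intro mult_right_mono powr_mono2) auto
  also have "\<dots> = e powr (1 - r) * s powr r"
    using mult_powr_diff_one[of s r] assms powr_minus[of e "r - 1"]
    by (simp add: powr_divide field_simps)
  finally show ?thesis using assms by (simp add: add_increasing)
qed

section \<open>Bellman functions\<close>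

text \<open>The inequality says that \<open>F\<close> does not increase in the mean when a Haar term of height \<open>a\<close> is
  added at a point where the partial sum is \<open>c\<close> and the partial square sum is \<open>s\<close>. Evenness is
  needed for the constant Haar function, which has no negative half: there the value at \<open>a\<close> must
  itself be the mean of the values at \<open>a\<close> and \<open>- a\<close>.\<close>

definition supersolution :: "(real \<Rightarrow> real \<Rightarrow> real) \<Rightarrow> bool" where
  "supersolution F \<longleftrightarrow> F 0 0 = 0 \<and> (\<forall>c s. F (- c) s = F c s) \<and>
     (\<forall>c s a. 0 \<le> s \<longrightarrow> F (c + a) (s + a\<^sup>2) + F (c - a) (s + a\<^sup>2) \<le> 2 * F c s)"

text \<open>Adding \<open>a\<^sup>2\<close> to \<open>s\<close> raises \<open>s\<^sup>r\<close> by at most \<open>r a\<^sup>2 (s + a\<^sup>2)\<^sup>r\<^sup>-\<^sup>1\<close>, by convexity, while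
  the mean of \<open>f\<^sup>2\<close> rises by exactly \<open>a\<^sup>2\<close>, so the subtracted term rises by at least as much.\<close>

lemma supersolution_lower:
  assumes r: "1 < r"
  shows "supersolution (\<lambda>f s. s powr r - r * f\<^sup>2 * s powr (r - 1))"
  unfolding supersolution_def
proof (intro conjI allI impI)
  fix c s a :: real assume s: "0 \<le> s"
  let ?s = "s + a\<^sup>2"
  have "?s powr r - s powr r \<le> r * ?s powr (r - 1) * a\<^sup>2"
    using powr_diff_le[of r ?s s] r s by simp
  moreover have "r * c\<^sup>2 * s powr (r - 1) \<le> r * c\<^sup>2 * ?s powr (r - 1)"
    using r s by (intro mult_left_mono powr_mono2) auto
  ultimately show "?s powr r - r * (c + a)\<^sup>2 * ?s powr (r - 1)
      + (?s powr r - r * (c - a)\<^sup>2 * ?s powr (r - 1))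
      \<le> 2 * (s powr r - r * c\<^sup>2 * s powr (r - 1))"
    by (simp add: power2_eq_square algebra_simps)
qed (use r in auto)

text \<open>With \<open>u = f\<^sup>2 + s\<close>, the mean of \<open>u\<^sup>r\<close> rises by at most \<open>C (u\<^sup>r\<^sup>-\<^sup>1 a\<^sup>2 + (a\<^sup>2)\<^sup>r)\<close>. The
  two subtracted terms pay for it: \<open>u\<^sup>r\<^sup>-\<^sup>1 s\<close> rises by at least \<open>u\<^sup>r\<^sup>-\<^sup>1 a\<^sup>2\<close>, since \<open>u\<^sup>r\<^sup>-\<^sup>1\<close>
  increases in the mean, and \<open>s\<^sup>r\<close> rises by at least \<open>(a\<^sup>2)\<^sup>r\<close>. Using \<open>u\<close> in place of \<open>f\<^sup>2\<close> is
  what makes a single argument cover all \<open>r > 1\<close>.\<close>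

lemma supersolution_upper:
  assumes r: "1 < r"
  obtains C where "1 \<le> C"
    "supersolution (\<lambda>f s. (f\<^sup>2 + s) powr r - C * (f\<^sup>2 + s) powr (r - 1) * s - C * s powr r)"
proof -
  obtain C where C: "1 \<le> C" "\<And>u f d. f\<^sup>2 \<le> u \<Longrightarrow>
     (u + 2 * d\<^sup>2 + 2 * f * d) powr r + (u + 2 * d\<^sup>2 - 2 * f * d) powr r
     \<le> 2 * u powr r + 2 * C * (u powr (r - 1) * d\<^sup>2 + (d\<^sup>2) powr r)"
    using powr_symmetric_increment[OF r] by blast
  let ?F = "\<lambda>f s. (f\<^sup>2 + s) powr r - C * (f\<^sup>2 + s) powr (r - 1) * s - C * s powr r"
  have "supersolution ?F"
    unfolding supersolution_def
  proof (intro conjI allI impI)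
    fix c s a :: real assume s: "0 \<le> s"
    define u where "u = c\<^sup>2 + s"
    have 1: "(c + a)\<^sup>2 + (s + a\<^sup>2) = u + 2 * a\<^sup>2 + 2 * c * a"
      and 2: "(c - a)\<^sup>2 + (s + a\<^sup>2) = u + 2 * a\<^sup>2 - 2 * c * a"
      by (auto simp: u_def power2_eq_square algebra_simps)
    have cu: "c\<^sup>2 \<le> u" "0 \<le> u" using s by (auto simp: u_def)
    have "c\<^sup>2 * a\<^sup>2 \<le> u * a\<^sup>2" using cu by (intro mult_right_mono) auto
    then have "0 \<le> 4 * (u * a\<^sup>2 - c\<^sup>2 * a\<^sup>2) + 4 * (a\<^sup>2)\<^sup>2" by simp
    also have "\<dots> = (u + 2 * a\<^sup>2 + 2 * c * a) * (u + 2 * a\<^sup>2 - 2 * c * a) - u\<^sup>2"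
      by (simp add: power2_eq_square algebra_simps)
    finally have "2 * u powr (r - 1)
        \<le> (u + 2 * a\<^sup>2 + 2 * c * a) powr (r - 1) + (u + 2 * a\<^sup>2 - 2 * c * a) powr (r - 1)"
      using r cu s by (intro powr_product_mean) (auto simp flip: 1 2)
    then have "C * (s + a\<^sup>2) * (2 * u powr (r - 1)) \<le> C * (s + a\<^sup>2) *
        ((u + 2 * a\<^sup>2 + 2 * c * a) powr (r - 1) + (u + 2 * a\<^sup>2 - 2 * c * a) powr (r - 1))"
      using C s by (intro mult_left_mono) auto
    moreover have "C * (s powr r + (a\<^sup>2) powr r) \<le> C * (s + a\<^sup>2) powr r"
      using C s r by (intro mult_left_mono powr_add_superadditive) auto
    ultimately show "?F (c + a) (s + a\<^sup>2) + ?F (c - a) (s + a\<^sup>2) \<le> 2 * ?F c s"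
      using C(2)[OF cu(1), of a] unfolding 1 2 u_def[symmetric] by (simp add: algebra_simps)
  qed auto
  with C(1) show ?thesis by (rule that)
qed

text \<open>Absorption of the mixed term turns the first Bellman function into a majorant of a difference
  of pure powers, whose integral compares the two sides of the square function estimate; the next
  lemma does the same for the second one.\<close>

lemma bellman_lower_majorizes:
  fixes r :: real
  assumes r: "1 < r"
  obtains C where "0 < C"
    "\<And>f s. 0 \<le> s \<Longrightarrow> s powr r / 2 - C * \<bar>f\<bar> powr (2 * r) \<le> s powr r - r * f\<^sup>2 * s powr (r - 1)"
proof
  \<comment> \<open>half of \<open>s powr r\<close> pays for the mixed term\<close>
  define e where "e = 1 / (2 * r)"
  show "0 < r * e powr (1 - r)" using r by (auto simp: e_def)
  fix f s :: real assume s: "0 \<le> s"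
  have "r * (s powr (r - 1) * f\<^sup>2) \<le> r * (e * s powr r + e powr (1 - r) * (f\<^sup>2) powr r)"
    using r s by (intro mult_left_mono powr_split_small) (auto simp: e_def)
  also have "\<dots> = r * e * s powr r + r * e powr (1 - r) * (f\<^sup>2) powr r"
    by (simp add: distrib_left)
  also have "r * e = 1 / 2" using r by (simp add: e_def)
  also have "(f\<^sup>2) powr r = \<bar>f\<bar> powr (2 * r)"
    by (metis abs_ge_zero powr_powr powr_numeral power2_abs)
  finally show "s powr r / 2 - r * e powr (1 - r) * \<bar>f\<bar> powr (2 * r)
      \<le> s powr r - r * f\<^sup>2 * s powr (r - 1)"
    by (simp add: mult_ac)
qed

lemma bellman_upper_majorizes:
  fixes r C :: real
  assumes r: "1 < r" and C: "1 \<le> C"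
  obtains C' where "0 < C'" "\<And>f s. 0 \<le> s \<Longrightarrow> \<bar>f\<bar> powr (2 * r) / 2 - C' * s powr r
     \<le> (f\<^sup>2 + s) powr r - C * (f\<^sup>2 + s) powr (r - 1) * s - C * s powr r"
proof
  \<comment> \<open>half of \<open>(f\<^sup>2 + s) powr r\<close> pays for the mixed term\<close>
  define e where "e = 1 / (2 * C)"
  show "0 < C + C * e powr (1 - r)" using C by (auto simp: e_def add_pos_nonneg)
  fix f s :: real assume s: "0 \<le> s"
  have "C * ((f\<^sup>2 + s) powr (r - 1) * s)
      \<le> C * (e * (f\<^sup>2 + s) powr r + e powr (1 - r) * s powr r)"
    using r C s by (intro mult_left_mono powr_split_small) (auto simp: e_def)
  also have "\<dots> = C * e * (f\<^sup>2 + s) powr r + C * e powr (1 - r) * s powr r"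
    by (simp add: distrib_left)
  also have "C * e = 1 / 2" using C by (simp add: e_def)
  finally have 1: "C * (f\<^sup>2 + s) powr (r - 1) * s
      \<le> 1 / 2 * (f\<^sup>2 + s) powr r + C * e powr (1 - r) * s powr r" by (simp only: mult.assoc)
  have "(f\<^sup>2) powr r = \<bar>f\<bar> powr (2 * r)"
    by (metis abs_ge_zero powr_powr powr_numeral power2_abs)
  moreover have "(f\<^sup>2) powr r \<le> (f\<^sup>2 + s) powr r" using s r by (intro powr_mono2) auto
  ultimately show "\<bar>f\<bar> powr (2 * r) / 2 - (C + C * e powr (1 - r)) * s powr r
     \<le> (f\<^sup>2 + s) powr r - C * (f\<^sup>2 + s) powr (r - 1) * s - C * s powr r"
    using 1 unfolding distrib_right by linarith
qed

section \<open>The Haar system\<close>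

text \<open>The interval \<open>[k / 2\<^sup>j, (k + 1) / 2\<^sup>j)\<close>, described by the floor function so that nesting and
  disjointness become statements about integer division.\<close>

definition dyadic :: "nat \<Rightarrow> nat \<Rightarrow> real set" where
  "dyadic j k = {x. \<lfloor>2 ^ j * x\<rfloor> = int k}"

text \<open>The Haar functions have values in \<open>{-1, 0, 1}\<close>, without normalization in \<open>L\<^sub>p\<close>, so that
  \<open>h\<^sub>n\<^sup>2\<close> is the indicator function of the support. The positive index \<open>2\<^sup>j + k\<close> with \<open>k < 2\<^sup>j\<close>
  belongs to the support \<open>dyadic j k\<close>.\<close>

definition haar :: "nat \<Rightarrow> real \<Rightarrow> real" where
  "haar n x = (if n = 0 then 1 else
     let j = floor_log n; k = n - 2 ^ j in
     indicator (dyadic (Suc j) (2 * k)) x - indicator (dyadic (Suc j) (2 * k + 1)) x)"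

lemma dyadic_eq_atLeastLessThan: "dyadic j k = {real k / 2 ^ j ..< (real k + 1) / 2 ^ j}"
  by (auto simp: dyadic_def floor_eq_iff field_simps)

lemma floor_dyadic_coarsen:
  assumes "i \<le> j"
  shows "\<lfloor>2 ^ i * (x::real)\<rfloor> = \<lfloor>2 ^ j * x\<rfloor> div 2 ^ (j - i)"
proof -
  have "2 ^ i * x = 2 ^ j * x / real_of_int (2 ^ (j - i))"
    using assms by (simp flip: power_add add: field_simps)
  then show ?thesis using floor_divide_real_eq_div[of "2 ^ (j - i)" "2 ^ j * x"] by simp
qed

lemma dyadic_split: "dyadic j k = dyadic (Suc j) (2 * k) \<union> dyadic (Suc j) (2 * k + 1)"
  using floor_dyadic_coarsen[of j "Suc j"] by (auto simp: dyadic_def)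

lemma dyadic_disjoint: "k \<noteq> l \<Longrightarrow> dyadic j k \<inter> dyadic j l = {}"
  by (auto simp: dyadic_def)

lemma haar_index:
  fixes n :: nat
  assumes "0 < n"
  obtains j k where "n = 2 ^ j + k" "k < 2 ^ j"
proof
  show "n = 2 ^ floor_log n + (n - 2 ^ floor_log n)"
    using floor_log_exp2_le[OF assms] by simp
  show "n - 2 ^ floor_log n < 2 ^ floor_log n"
    using floor_log_exp2_le[OF assms] floor_log_exp2_gt[of n] by linarith
qed

lemma haar_0 [simp]: "haar 0 = (\<lambda>_. 1)"
  by (simp add: haar_def fun_eq_iff)

lemma haar_dyadic:
  assumes "k < 2 ^ j"
  shows "haar (2 ^ j + k) = (\<lambda>x. indicator (dyadic (Suc j) (2 * k)) x - indicator (dyadic (Suc j) (2 * k + 1)) x)"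
proof -
  have "floor_log (2 ^ j + k) = j" using assms by (intro floor_log_eqI) auto
  then show ?thesis by (simp add: haar_def fun_eq_iff)
qed

lemma haar_power2_dyadic:
  assumes "k < 2 ^ j"
  shows "(haar (2 ^ j + k) x)\<^sup>2 = indicator (dyadic j k) x"
  using dyadic_split[of j k] dyadic_disjoint[of "2 * k" "2 * k + 1" "Suc j"]
  by (auto simp: haar_dyadic[OF assms] indicator_def)

lemma haar_power2_le_one: "(haar n x)\<^sup>2 \<le> 1"
proof (cases "n = 0")
  case False
  then obtain j k where "n = 2 ^ j + k" "k < 2 ^ j" using haar_index by blast
  then show ?thesis by (simp add: haar_power2_dyadic)
qed auto

lemma abs_haar_le_one: "\<bar>haar n x\<bar> \<le> 1"
  using haar_power2_le_one[of n x] by (simp add: abs_square_le_1)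

text \<open>The martingale structure of the Haar system: its earlier members do not see the inside of the
  support of a later one. A Haar function of level \<open>i\<close> depends only on the dyadic interval of
  level \<open>i + 1\<close> around its argument; two members of the same level have disjoint supports.\<close>

lemma haar_const_on_dyadic:
  assumes "m < 2 ^ j + k" "k < 2 ^ j" "x \<in> dyadic j k" "y \<in> dyadic j k"
  shows "haar m x = haar m y"
proof (cases "m = 0")
  case False
  then obtain i l where m: "m = 2 ^ i + l" "l < 2 ^ i" using haar_index by blast
  have "(2::nat) ^ i < 2 ^ Suc j" using assms(1,2) m by simp
  then have "i \<le> j" by (metis less_Suc_eq_le nat_power_less_imp_less pos2)
  show ?thesis
  proof (cases "i = j")
    case True
    have "x \<notin> dyadic j l" "y \<notin> dyadic j l"
      using dyadic_disjoint[of l k j] assms True m by auto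
    then have "haar m x = 0" "haar m y = 0"
      using haar_power2_dyadic[OF m(2), of x] haar_power2_dyadic[OF m(2), of y] True m by auto
    then show ?thesis by simp
  next
    case False
    then have "Suc i \<le> j" using \<open>i \<le> j\<close> by simp
    then have "\<lfloor>2 ^ Suc i * x\<rfloor> = \<lfloor>2 ^ Suc i * y\<rfloor>"
      using floor_dyadic_coarsen[of "Suc i" j x] floor_dyadic_coarsen[of "Suc i" j y] assms(3,4)
      by (simp add: dyadic_def)
    then show ?thesis unfolding m(1) haar_dyadic[OF m(2)] by (simp add: indicator_def dyadic_def)
  qed
qed auto

interpretation unit: finite_measure unit_leb
  by (rule finite_measure_lebesgue_on) simp

lemma measure_unit_leb [simp]: "measure unit_leb {0..1} = 1"
  by (simp add: measure_restrict_space)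

lemma dyadic_sets_borel [measurable]: "dyadic j k \<in> sets borel"
  by (simp add: dyadic_eq_atLeastLessThan)

lemma dyadic_subset:
  assumes "k < 2 ^ j" shows "dyadic j k \<subseteq> {0..1}"
proof -
  have "(real k + 1) \<le> 2 ^ j" using assms by (metis Suc_eq_plus1 Suc_leI of_nat_1 of_nat_add of_nat_le_iff of_nat_numeral of_nat_power)
  then have 1: "(real k + 1) / 2 ^ j \<le> 1" by simp
  have 0: "0 \<le> real k / 2 ^ j" by simp
  show ?thesis unfolding dyadic_eq_atLeastLessThan using 0 1
    by (metis atLeastLessThan_subseteq_atLeastAtMost_iff)
qed

lemma dyadic_in_sets_unit_leb [measurable]:
  "k < 2 ^ j \<Longrightarrow> dyadic j k \<in> sets unit_leb"
  using dyadic_subset[of k j] dyadic_sets_borel[of j k] by (auto simp: sets_restrict_space_iff)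

lemma measure_dyadic:
  assumes "k < 2 ^ j" shows "measure unit_leb (dyadic j k) = 1 / 2 ^ j"
proof -
  have "measure unit_leb (dyadic j k) = measure lebesgue (dyadic j k)"
    using dyadic_subset[OF assms] by (intro measure_restrict_space) auto
  also have "\<dots> = 1 / 2 ^ j"
    by (simp add: dyadic_eq_atLeastLessThan field_simps)
  finally show ?thesis .
qed

lemma simple_function_haar: "simple_function unit_leb (haar n)"
proof (cases "n = 0")
  case False
  then obtain j k where "n = 2 ^ j + k" "k < 2 ^ j" using haar_index by blast
  then show ?thesis by (auto simp: haar_dyadic intro!: simple_function_diff simple_function_indicator)
qed (auto)

lemma borel_measurable_haar [measurable]: "haar n \<in> borel_measurable unit_leb"
  using simple_function_haar by (rule borel_measurable_simple_function)

lemma integrable_simple: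
  fixes f :: "real \<Rightarrow> real"
  shows "simple_function unit_leb f \<Longrightarrow> integrable unit_leb f"
  by (rule integrable_simple_function) auto

section \<open>The square function of a Haar sum\<close>

definition haar_sum :: "(nat \<Rightarrow> real) \<Rightarrow> nat \<Rightarrow> real \<Rightarrow> real" where
  "haar_sum a m x = (\<Sum>n<m. a n * haar n x)"

definition haar_square :: "(nat \<Rightarrow> real) \<Rightarrow> nat \<Rightarrow> real \<Rightarrow> real" where
  "haar_square a m x = (\<Sum>n<m. (a n)\<^sup>2 * (haar n x)\<^sup>2)"

lemma simple_function_haar_sum: "simple_function unit_leb (haar_sum a m)"
  unfolding haar_sum_def[abs_def]
  by (intro simple_function_sum simple_function_mult simple_function_const simple_function_haar)

lemma simple_function_haar_square: "simple_function unit_leb (haar_square a m)"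
  unfolding haar_square_def[abs_def] power2_eq_square
  by (intro simple_function_sum simple_function_mult simple_function_const simple_function_haar)

lemma borel_measurable_haar_sum: "haar_sum a m \<in> borel_measurable unit_leb"
  by (rule borel_measurable_simple_function[OF simple_function_haar_sum])

lemma haar_square_nonneg: "0 \<le> haar_square a m x"
  unfolding haar_square_def by (intro sum_nonneg) auto

lemma haar_square_mono: "m \<le> m' \<Longrightarrow> haar_square a m x \<le> haar_square a m' x"
  unfolding haar_square_def by (intro sum_mono2) auto

text \<open>Partial sums are simple functions, and so is every function of them.\<close>

lemma integrable_haar_pair:
  fixes G :: "real \<Rightarrow> real \<Rightarrow> real"
  shows "integrable unit_leb (\<lambda>x. G (haar_sum a m x) (haar_square a m x))"
  by (rule integrable_simple, rule simple_function_compose2[OF simple_function_haar_sum simple_function_haar_square])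

text \<open>Outside the support of the new Haar function nothing changes. On the support, the old pair is a
  constant \<open>(c, s)\<close>, and the two halves have equal measure, so the integral changes by a positive
  multiple of \<open>F (c + a) (s + a\<^sup>2) + F (c - a) (s + a\<^sup>2) - 2 F c s\<close>. For the constant Haar
  function, evenness of \<open>F\<close> takes the place of the second half.\<close>

lemma integral_haar_supersolution_step:
  assumes F: "supersolution F"
  shows "(LINT x|unit_leb. F (haar_sum a (Suc m) x) (haar_square a (Suc m) x))
     \<le> (LINT x|unit_leb. F (haar_sum a m x) (haar_square a m x))"
proof (cases "m = 0")
  case True
  have 0: "haar_sum a 0 = (\<lambda>_. 0)" "haar_square a 0 = (\<lambda>_. 0)"
    "haar_sum a (Suc 0) = (\<lambda>_. a 0)" "haar_square a (Suc 0) = (\<lambda>_. (a 0)\<^sup>2)"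
    by (auto simp: haar_sum_def haar_square_def fun_eq_iff)
  have "F (a 0) ((a 0)\<^sup>2) + F (- a 0) ((a 0)\<^sup>2) \<le> 2 * F 0 0"
    using F unfolding supersolution_def by (metis add_0 diff_0 order_refl)
  then have "F (a 0) ((a 0)\<^sup>2) \<le> 0" "F 0 0 = 0" using F by (auto simp: supersolution_def)
  then show ?thesis by (simp add: True 0)
next
  case False
  then obtain j k where m: "m = 2 ^ j + k" "k < 2 ^ j" using haar_index by blast
  let ?A = "dyadic (Suc j) (2 * k)" and ?B = "dyadic (Suc j) (2 * k + 1)"
  define z where "z = real k / 2 ^ j"
  have z: "z \<in> dyadic j k" by (auto simp: z_def dyadic_eq_atLeastLessThan divide_strict_right_mono)
  define c s where "c = haar_sum a m z" and "s = haar_square a m z"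
  have const: "haar_sum a m x = c" "haar_square a m x = s" if "x \<in> dyadic j k" for x
    using haar_const_on_dyadic[OF _ m(2) that z] m
    by (auto simp: c_def s_def haar_sum_def haar_square_def)
  let ?f = "\<lambda>x. F (haar_sum a m x) (haar_square a m x)"
  let ?p = "F (c + a m) (s + (a m)\<^sup>2) - F c s" and ?q = "F (c - a m) (s + (a m)\<^sup>2) - F c s"
  have step: "F (haar_sum a (Suc m) x) (haar_square a (Suc m) x)
      = ?f x + (?p * indicator ?A x + ?q * indicator ?B x)" for x
    using const[of x] dyadic_split[of j k] dyadic_disjoint[of "2 * k" "2 * k + 1" "Suc j"]
    by (auto simp: haar_sum_def haar_square_def m haar_dyadic indicator_def)
  have k2: "2 * k < 2 ^ Suc j" "2 * k + 1 < 2 ^ Suc j" using m(2) by auto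
  have f: "integrable unit_leb ?f"
    by (rule integrable_haar_pair)
  have s: "0 \<le> s" by (simp add: s_def haar_square_nonneg)
  have AB: "integrable unit_leb (indicator ?A :: real \<Rightarrow> real)" "integrable unit_leb (indicator ?B :: real \<Rightarrow> real)"
    using k2 by (auto intro!: integrable_simple simple_function_indicator)
  have "(LINT x|unit_leb. F (haar_sum a (Suc m) x) (haar_square a (Suc m) x))
     = (LINT x|unit_leb. ?f x) + (?p * measure unit_leb ?A + ?q * measure unit_leb ?B)"
    unfolding step using f AB k2
    by (subst Bochner_Integration.integral_add Bochner_Integration.integral_mult_right_zero; (auto simp: Int_absorb2[OF dyadic_subset])?)+
  also have "\<dots> = (LINT x|unit_leb. ?f x) + (?p + ?q) / 2 ^ Suc j"
    unfolding measure_dyadic[OF k2(1)] measure_dyadic[OF k2(2)] by (simp add: add_divide_distrib diff_divide_distrib)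
  also have "?p + ?q \<le> 0"
    using F s unfolding supersolution_def by (auto simp: algebra_simps)
  finally show ?thesis by (simp add: divide_right_mono)
qed

lemma integral_haar_supersolution:
  assumes F: "supersolution F"
  shows "(LINT x|unit_leb. F (haar_sum a m x) (haar_square a m x)) \<le> 0"
proof (induction m)
  case 0
  then show ?case using F by (simp add: haar_sum_def haar_square_def supersolution_def)
next
  case (Suc m)
  then show ?case using integral_haar_supersolution_step[OF F, of a m] by linarith
qed

lemma integral_haar_majorant:
  assumes F: "supersolution F" and G: "\<And>f s. 0 \<le> s \<Longrightarrow> G f s \<le> F f s"
  shows "(LINT x|unit_leb. G (haar_sum a m x) (haar_square a m x)) \<le> 0"
proof -
  have "(LINT x|unit_leb. G (haar_sum a m x) (haar_square a m x))
     \<le> (LINT x|unit_leb. F (haar_sum a m x) (haar_square a m x))"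
    by (intro integral_mono integrable_haar_pair G haar_square_nonneg)
  then show ?thesis using integral_haar_supersolution[OF F, of a m] by linarith
qed

text \<open>Littlewood--Paley inequalities for finite Haar sums, with a constant independent of the number
  of terms: each Bellman function majorizes the difference of the two sides, and its integral is
  at most its value \<open>0\<close> at the empty sum.\<close>

lemma haar_square_function_equivalence:
  fixes p :: real
  assumes p: "2 < p"
  obtains K where "1 \<le> K"
    "\<And>a m. (LINT x|unit_leb. haar_square a m x powr (p / 2))
            \<le> K * (LINT x|unit_leb. \<bar>haar_sum a m x\<bar> powr p)"
    "\<And>a m. (LINT x|unit_leb. \<bar>haar_sum a m x\<bar> powr p)
            \<le> K * (LINT x|unit_leb. haar_square a m x powr (p / 2))"
proof -
  define r where "r = p / 2"
  have r: "1 < r" "2 * r = p" using p by (auto simp: r_def)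
  obtain C1 where C1: "0 < C1" "\<And>f s. 0 \<le> s \<Longrightarrow>
      s powr r / 2 - C1 * \<bar>f\<bar> powr (2 * r) \<le> s powr r - r * f\<^sup>2 * s powr (r - 1)"
    using bellman_lower_majorizes[OF r(1)] by blast
  obtain C where C: "1 \<le> C"
    "supersolution (\<lambda>f s. (f\<^sup>2 + s) powr r - C * (f\<^sup>2 + s) powr (r - 1) * s - C * s powr r)"
    using supersolution_upper[OF r(1)] by blast
  obtain C2 where C2: "0 < C2" "\<And>f s. 0 \<le> s \<Longrightarrow> \<bar>f\<bar> powr (2 * r) / 2 - C2 * s powr r
     \<le> (f\<^sup>2 + s) powr r - C * (f\<^sup>2 + s) powr (r - 1) * s - C * s powr r"
    using bellman_upper_majorizes[OF r(1) C(1)] by blast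
  define K where "K = 1 + 2 * C1 + 2 * C2"
  have i1: "integrable unit_leb (\<lambda>x. haar_square a m x powr r)" for a m using integrable_haar_pair[of "\<lambda>f s. s powr r"] by simp
  have i2: "integrable unit_leb (\<lambda>x. \<bar>haar_sum a m x\<bar> powr (2 * r))" for a m using integrable_haar_pair[of "\<lambda>f s. \<bar>f\<bar> powr (2 * r)"] by simp
  show ?thesis
  proof
    show "1 \<le> K" using C1 C2 by (simp add: K_def)
    fix a m
    let ?S = "LINT x|unit_leb. haar_square a m x powr r" and ?T = "LINT x|unit_leb. \<bar>haar_sum a m x\<bar> powr (2 * r)"
    have pos: "0 \<le> ?S" "0 \<le> ?T" by (auto intro!: integral_nonneg_AE)
    have "?S / 2 - C1 * ?T \<le> 0"
      using integral_haar_majorant[OF supersolution_lower[OF r(1)] C1(2), of a m] i1[of a m] i2[of a m] by simp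
    moreover have "?T / 2 - C2 * ?S \<le> 0"
      using integral_haar_majorant[OF C(2) C2(2), of a m] i1[of a m] i2[of a m] by simp
    moreover have "0 \<le> C1 * ?S" "0 \<le> C2 * ?S" "0 \<le> C1 * ?T" "0 \<le> C2 * ?T" using C1 C2 pos by auto
    moreover have "K * ?S = ?S + 2 * (C1 * ?S) + 2 * (C2 * ?S)" "K * ?T = ?T + 2 * (C1 * ?T) + 2 * (C2 * ?T)"
      by (simp_all add: K_def algebra_simps)
    ultimately have "?S \<le> K * ?T" "?T \<le> K * ?S" using pos by linarith+
    then show "(LINT x|unit_leb. haar_square a m x powr (p / 2)) \<le> K * (LINT x|unit_leb. \<bar>haar_sum a m x\<bar> powr p)"
       "(LINT x|unit_leb. \<bar>haar_sum a m x\<bar> powr p) \<le> K * (LINT x|unit_leb. haar_square a m x powr (p / 2))"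
      using r(2) by (simp_all add: r_def)
  qed
qed

section \<open>The modular of a function on the unit interval\<close>

definition p_integrable :: "real \<Rightarrow> (real \<Rightarrow> real) \<Rightarrow> bool" where
  "p_integrable p f \<longleftrightarrow> f \<in> borel_measurable unit_leb \<and> integrable unit_leb (\<lambda>x. \<bar>f x\<bar> powr p)"

definition modular :: "real \<Rightarrow> (real \<Rightarrow> real) \<Rightarrow> real" where
  "modular p f = (LINT x|unit_leb. \<bar>f x\<bar> powr p)"

lemma modular_nonneg: "0 \<le> modular p f"
  unfolding modular_def by (intro integral_nonneg_AE) auto

lemma p_integrable_add:
  assumes p: "0 \<le> p" and f: "p_integrable p f" and g: "p_integrable p g"
  shows "p_integrable p (\<lambda>x. f x + g x)"
    and "modular p (\<lambda>x. f x + g x) \<le> 2 powr p * (modular p f + modular p g)"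
proof -
  have [measurable]: "f \<in> borel_measurable unit_leb" "g \<in> borel_measurable unit_leb"
    using f g by (auto simp: p_integrable_def)
  have i: "integrable unit_leb (\<lambda>x. \<bar>f x\<bar> powr p)" "integrable unit_leb (\<lambda>x. \<bar>g x\<bar> powr p)"
    using f g by (auto simp: p_integrable_def)
  have le: "\<bar>f x + g x\<bar> powr p \<le> 2 powr p * (\<bar>f x\<bar> powr p + \<bar>g x\<bar> powr p)" for x
  proof -
    have "\<bar>f x + g x\<bar> powr p \<le> (\<bar>f x\<bar> + \<bar>g x\<bar>) powr p"
      using p by (intro powr_mono2) auto
    also have "\<dots> \<le> 2 powr p * (\<bar>f x\<bar> powr p + \<bar>g x\<bar> powr p)"
      using p by (intro powr_add_le) auto
    finally show ?thesis .
  qed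
  have int: "integrable unit_leb (\<lambda>x. \<bar>f x + g x\<bar> powr p)"
    by (rule Bochner_Integration.integrable_bound[of _ "\<lambda>x. 2 powr p * (\<bar>f x\<bar> powr p + \<bar>g x\<bar> powr p)"])
      (use i le in auto)
  then show "p_integrable p (\<lambda>x. f x + g x)" by (simp add: p_integrable_def)
  have "modular p (\<lambda>x. f x + g x) \<le> (LINT x|unit_leb. 2 powr p * (\<bar>f x\<bar> powr p + \<bar>g x\<bar> powr p))"
    unfolding modular_def using i int le by (intro integral_mono) auto
  also have "\<dots> = 2 powr p * (modular p f + modular p g)"
    using i by (simp add: modular_def)
  finally show "modular p (\<lambda>x. f x + g x) \<le> 2 powr p * (modular p f + modular p g)" .
qed

lemma p_integrable_uminus: "p_integrable p f \<Longrightarrow> p_integrable p (\<lambda>x. - f x)"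
  by (simp add: p_integrable_def)

lemma modular_uminus [simp]: "modular p (\<lambda>x. - f x) = modular p f"
  by (simp add: modular_def)

lemma modular_minus_commute: "modular p (\<lambda>x. f x - g x) = modular p (\<lambda>x. g x - f x)"
  by (simp add: modular_def abs_minus_commute)

lemma p_integrable_diff:
  assumes p: "0 \<le> p" and f: "p_integrable p f" and g: "p_integrable p g"
  shows "p_integrable p (\<lambda>x. f x - g x)"
    and "modular p (\<lambda>x. f x - g x) \<le> 2 powr p * (modular p f + modular p g)"
  using p_integrable_add[OF p f p_integrable_uminus[OF g]] by simp_all

lemma modular_triangle:
  assumes p: "0 \<le> p" and f: "p_integrable p f" and g: "p_integrable p g"
  shows "modular p f \<le> 2 powr p * (modular p g + modular p (\<lambda>x. f x - g x))"
  using p_integrable_add(2)[OF p g p_integrable_diff(1)[OF p f g]] by simp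

lemma p_integrable_simple:
  assumes "simple_function unit_leb f"
  shows "p_integrable p f"
  unfolding p_integrable_def
  using assms by (auto intro!: integrable_simple simple_function_compose1[of _ f "\<lambda>y. \<bar>y\<bar> powr p"]
      borel_measurable_simple_function)

lemma p_integrable_haar_sum: "p_integrable p (haar_sum a m)"
  by (intro p_integrable_simple simple_function_haar_sum)

text \<open>Jensen's inequality on the unit interval, by integrating the tangent inequality at the mean of
  \<open>\<bar>f\<bar>\<close>. The tangent at \<open>1\<close> yields integrability.\<close>

lemma
  assumes p: "1 < p" and f: "p_integrable p f"
  shows integrable_p_integrable: "integrable unit_leb f"
    and integral_abs_le_modular: "(LINT x|unit_leb. \<bar>f x\<bar>) powr p \<le> modular p f"
proof -
  have [measurable]: "f \<in> borel_measurable unit_leb" and i: "integrable unit_leb (\<lambda>x. \<bar>f x\<bar> powr p)"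
    using f by (auto simp: p_integrable_def)
  have "p * \<bar>f x\<bar> \<le> \<bar>f x\<bar> powr p + (p - 1)" for x
    using powr_tangent[of p 1 "\<bar>f x\<bar>"] p by simp
  moreover have "\<bar>f x\<bar> \<le> p * \<bar>f x\<bar>" for x
    using mult_right_mono[of 1 p "\<bar>f x\<bar>"] p by simp
  ultimately have le: "\<bar>f x\<bar> \<le> \<bar>f x\<bar> powr p + (p - 1)" for x
    by (meson order_trans)
  show int: "integrable unit_leb f"
    by (rule Bochner_Integration.integrable_bound[of _ "\<lambda>x. \<bar>f x\<bar> powr p + (p - 1)"])
      (use i le p in \<open>auto intro: order_trans[OF _ abs_ge_self]\<close>)
  define A where "A = (LINT x|unit_leb. \<bar>f x\<bar>)"
  have A: "0 \<le> A" unfolding A_def by (intro integral_nonneg_AE) auto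
  have "(LINT x|unit_leb. p * A powr (p - 1) * \<bar>f x\<bar>) \<le> (LINT x|unit_leb. \<bar>f x\<bar> powr p + (p - 1) * A powr p)"
    using powr_tangent[OF p A] int i by (intro integral_mono) auto
  then have "p * A powr (p - 1) * A \<le> modular p f + (p - 1) * A powr p"
    using i by (simp add: modular_def A_def)
  moreover have "p * A powr (p - 1) * A = p * (A * A powr (p - 1))" by simp
  ultimately have "p * A powr p \<le> modular p f + (p - 1) * A powr p"
    by (simp only: mult_powr_diff_one[OF A])
  then show "(LINT x|unit_leb. \<bar>f x\<bar>) powr p \<le> modular p f"
    unfolding A_def[symmetric] by (simp add: algebra_simps)
qed

text \<open>Dominated convergence for the modular; each approximation step in the proof of density applies it.\<close>

lemma modular_tendsto_zero:
  assumes "0 < p" and [measurable]: "\<And>i. f i \<in> borel_measurable unit_leb"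
    and lim: "AE x in unit_leb. (\<lambda>i::nat. f i x) \<longlonglongrightarrow> 0"
    and bound: "\<And>i. AE x in unit_leb. \<bar>f i x\<bar> \<le> w x"
    and w: "integrable unit_leb (\<lambda>x. w x powr p)"
  shows "(\<lambda>i. modular p (f i)) \<longlonglongrightarrow> 0"
proof -
  have "(\<lambda>i. LINT x|unit_leb. \<bar>f i x\<bar> powr p) \<longlonglongrightarrow> (LINT x|unit_leb. 0)"
  proof (rule integral_dominated_convergence[OF _ _ w])
    show "AE x in unit_leb. (\<lambda>i. \<bar>f i x\<bar> powr p) \<longlonglongrightarrow> 0"
      using lim
    proof eventually_elim
      case (elim x)
      then have "(\<lambda>i. \<bar>f i x\<bar> powr p) \<longlonglongrightarrow> 0 powr p"
        using \<open>0 < p\<close> by (intro tendsto_powr' tendsto_rabs_zero tendsto_const) auto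
      then show ?case by simp
    qed
    show "AE x in unit_leb. norm (\<bar>f i x\<bar> powr p) \<le> w x powr p" for i
      using bound[of i] by eventually_elim (use \<open>0 < p\<close> in \<open>auto intro: powr_mono2\<close>)
  qed auto
  then show ?thesis by (simp add: modular_def)
qed

section \<open>Haar coefficients\<close>

lemma integral_haar_mult_eq_0:
  assumes "m < n"
  shows "(LINT x|unit_leb. haar m x * haar n x) = 0"
proof -
  obtain j k where n: "n = 2 ^ j + k" "k < 2 ^ j" using haar_index[of n] assms by auto
  define z where "z = real k / 2 ^ j"
  have z: "z \<in> dyadic j k" by (auto simp: z_def dyadic_eq_atLeastLessThan divide_strict_right_mono)
  let ?A = "dyadic (Suc j) (2 * k)" and ?B = "dyadic (Suc j) (2 * k + 1)"
  have k2: "2 * k < 2 ^ Suc j" "2 * k + 1 < 2 ^ Suc j" using n(2) by auto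
  have AB: "integrable unit_leb (indicator ?A :: real \<Rightarrow> real)" "integrable unit_leb (indicator ?B :: real \<Rightarrow> real)"
    using k2 by (auto intro!: integrable_simple simple_function_indicator)
  have "haar m x * haar n x = haar m z * (indicator ?A x - indicator ?B x)" for x
  proof (cases "x \<in> dyadic j k")
    case True
    then show ?thesis using haar_const_on_dyadic[OF _ n(2) True z] assms n by (simp add: haar_dyadic)
  next
    case False
    then show ?thesis using dyadic_split[of j k] n by (simp add: haar_dyadic)
  qed
  then have "(LINT x|unit_leb. haar m x * haar n x) = haar m z * (measure unit_leb ?A - measure unit_leb ?B)"
    using AB k2 Int_absorb2[OF dyadic_subset, of "2 * k" "Suc j"] Int_absorb2[OF dyadic_subset, of "2 * k + 1" "Suc j"]
    by simp
  also have "\<dots> = 0" using measure_dyadic[OF k2(1)] measure_dyadic[OF k2(2)] by simp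
  finally show ?thesis .
qed

lemma integrable_haar_mult: "integrable unit_leb (\<lambda>x. haar m x * haar n x)"
  by (intro integrable_simple simple_function_mult simple_function_haar)

lemma integral_haar_power2_pos: "0 < (LINT x|unit_leb. (haar n x)\<^sup>2)"
proof (cases "n = 0")
  case False
  then obtain j k where n: "n = 2 ^ j + k" "k < 2 ^ j" using haar_index by blast
  then have "(LINT x|unit_leb. (haar n x)\<^sup>2) = measure unit_leb (dyadic j k)"
    using Int_absorb2[OF dyadic_subset, of k j] by (simp add: haar_power2_dyadic)
  then show ?thesis using measure_dyadic[OF n(2)] by simp
qed simp

text \<open>The quotient compensates for the missing normalization of the Haar functions.\<close>

definition haar_coeff :: "(real \<Rightarrow> real) \<Rightarrow> nat \<Rightarrow> real" where
  "haar_coeff f n = (LINT x|unit_leb. f x * haar n x) / (LINT x|unit_leb. (haar n x)\<^sup>2)"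

lemma integrable_mult_haar:
  assumes "integrable unit_leb f" shows "integrable unit_leb (\<lambda>x. f x * haar n x)"
  using assms abs_haar_le_one[of n]
  by (intro Bochner_Integration.integrable_bound[OF assms])
    (auto simp: abs_mult intro!: mult_left_le)

lemma haar_coeff_haar_sum: "haar_coeff (haar_sum a m) n = (if n < m then a n else 0)"
proof -
  have "(LINT x|unit_leb. haar_sum a m x * haar n x) = (\<Sum>i<m. a i * (LINT x|unit_leb. haar i x * haar n x))"
    by (simp add: haar_sum_def sum_distrib_right mult.assoc integrable_haar_mult)
  also have "\<dots> = (\<Sum>i<m. if i = n then a n * (LINT x|unit_leb. (haar n x)\<^sup>2) else 0)"
    using integral_haar_mult_eq_0[of _ n] integral_haar_mult_eq_0[of n]
    by (intro sum.cong refl) (auto simp: power2_eq_square neq_iff mult.commute)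
  finally show ?thesis using integral_haar_power2_pos[of n] by (simp add: haar_coeff_def)
qed

lemma haar_coeff_diff:
  assumes "integrable unit_leb f" "integrable unit_leb g"
  shows "haar_coeff (\<lambda>x. f x - g x) n = haar_coeff f n - haar_coeff g n"
  using integrable_mult_haar[OF assms(1), of n] integrable_mult_haar[OF assms(2), of n]
  by (simp add: haar_coeff_def left_diff_distrib diff_divide_distrib)

lemma abs_haar_coeff_le:
  assumes f: "integrable unit_leb f"
  shows "\<bar>haar_coeff f n\<bar> \<le> (LINT x|unit_leb. \<bar>f x\<bar>) / (LINT x|unit_leb. (haar n x)\<^sup>2)"
proof -
  have "\<bar>LINT x|unit_leb. f x * haar n x\<bar> \<le> (LINT x|unit_leb. \<bar>f x * haar n x\<bar>)"
    by (rule integral_abs_bound)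
  also have "\<dots> \<le> (LINT x|unit_leb. \<bar>f x\<bar>)"
    using f abs_haar_le_one[of n]
    by (intro integral_mono integrable_abs integrable_mult_haar) (auto simp: abs_mult intro!: mult_left_le)
  finally show ?thesis
    using integral_haar_power2_pos[of n] by (simp add: haar_coeff_def abs_divide divide_right_mono)
qed

text \<open>A bound that depends on \<open>m\<close>. It expresses the continuity of each single projection, which
  carries the uniform bound from Haar sums over to their limits.\<close>

lemma modular_haar_projection_crude:
  assumes p: "1 < p"
  shows "\<exists>D\<ge>0. \<forall>f. p_integrable p f \<longrightarrow> modular p (haar_sum (haar_coeff f) m) \<le> D * modular p f"
proof -
  define c where "c = (\<Sum>n<m. 1 / (LINT x|unit_leb. (haar n x)\<^sup>2))"
  have "modular p (haar_sum (haar_coeff f) m) \<le> c powr p * modular p f" if f: "p_integrable p f" for f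
  proof -
    define A where "A = (LINT x|unit_leb. \<bar>f x\<bar>)"
    have A: "0 \<le> A" unfolding A_def by (intro integral_nonneg_AE) auto
    have c: "0 \<le> c" unfolding c_def by (intro sum_nonneg) auto
    note f1 = integrable_p_integrable[OF p f]
    have "\<bar>haar_sum (haar_coeff f) m x\<bar> \<le> c * A" for x
    proof -
      have "\<bar>haar_sum (haar_coeff f) m x\<bar> \<le> (\<Sum>n<m. \<bar>haar_coeff f n * haar n x\<bar>)"
        unfolding haar_sum_def by (rule sum_abs)
      also have "\<dots> \<le> (\<Sum>n<m. A / (LINT x|unit_leb. (haar n x)\<^sup>2) * 1)"
        unfolding abs_mult A_def using A
        by (intro sum_mono mult_mono abs_haar_coeff_le[OF f1] abs_haar_le_one)
           (auto intro!: divide_nonneg_nonneg integral_nonneg_AE)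
      also have "\<dots> = c * A" by (simp add: c_def sum_distrib_right)
      finally show ?thesis .
    qed
    then have "\<bar>haar_sum (haar_coeff f) m x\<bar> powr p \<le> (c * A) powr p" for x
      using p by (intro powr_mono2) auto
    then have "modular p (haar_sum (haar_coeff f) m) \<le> (LINT x|unit_leb. (c * A) powr p)"
      unfolding modular_def using p_integrable_haar_sum[of p]
      by (intro integral_mono) (auto simp: p_integrable_def)
    also have "\<dots> = c powr p * A powr p" by (simp add: powr_mult)
    also have "\<dots> \<le> c powr p * modular p f"
      unfolding A_def by (intro mult_left_mono integral_abs_le_modular[OF p f]) auto
    finally show ?thesis .
  qed
  then show ?thesis by (intro exI[of _ "c powr p"]) auto
qed

section \<open>Density of Haar sums\<close>

text \<open>Equality is required on the half-open interval only, since dyadic intervals miss the point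
  \<open>1\<close> where the constant Haar function does not vanish.\<close>

definition haar_combination :: "nat \<Rightarrow> (real \<Rightarrow> real) \<Rightarrow> bool" where
  "haar_combination m f \<longleftrightarrow> (\<exists>a. \<forall>x\<in>{0..<1}. f x = haar_sum a m x)"

lemma haar_combination_scale_add:
  assumes "haar_combination m f" "haar_combination m g"
  shows "haar_combination m (\<lambda>x. c * f x + d * g x)"
proof -
  obtain a b where "\<forall>x\<in>{0..<1}. f x = haar_sum a m x" "\<forall>x\<in>{0..<1}. g x = haar_sum b m x"
    using assms by (auto simp: haar_combination_def)
  then have "\<forall>x\<in>{0..<1}. c * f x + d * g x = haar_sum (\<lambda>n. c * a n + d * b n) m x"
    by (auto simp: haar_sum_def sum.distrib sum_distrib_left distrib_right mult.assoc)
  then show ?thesis unfolding haar_combination_def by blast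
qed

lemma haar_combination_sum:
  assumes "finite I" "\<And>i. i \<in> I \<Longrightarrow> haar_combination m (f i)"
  shows "haar_combination m (\<lambda>x. \<Sum>i\<in>I. c i * f i x)"
  using assms
proof (induction I rule: finite_induct)
  case empty
  then show ?case by (auto simp: haar_combination_def haar_sum_def intro!: exI[of _ "\<lambda>_. 0"])
next
  case (insert i I)
  then show ?case using haar_combination_scale_add[of m "f i" "\<lambda>x. \<Sum>i\<in>I. c i * f i x" "c i" 1] by simp
qed

lemma haar_sum_truncate:
  assumes "m \<le> m'"
  shows "haar_sum (\<lambda>n. if n < m then a n else 0) m' x = haar_sum a m x"
proof -
  have "haar_sum (\<lambda>n. if n < m then a n else 0) m' x = (\<Sum>n<m'. if n < m then a n * haar n x else 0)"
    unfolding haar_sum_def by (intro sum.cong) auto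
  also have "\<dots> = (\<Sum>n\<in>{..<m'} \<inter> {n. n < m}. a n * haar n x)" by (simp add: sum.If_cases)
  also have "{..<m'} \<inter> {n. n < m} = {..<m}" using assms by auto
  finally show ?thesis by (simp add: haar_sum_def)
qed

lemma haar_combination_mono:
  assumes "haar_combination m f" "m \<le> m'"
  shows "haar_combination m' f"
  using assms haar_sum_truncate[OF assms(2)] unfolding haar_combination_def by metis

lemma haar_combination_haar:
  assumes "n < m"
  shows "haar_combination m (haar n)"
  unfolding haar_combination_def
  by (rule exI[of _ "\<lambda>i. if i = n then 1 else 0"])
     (use assms in \<open>simp add: haar_sum_def if_distrib[of "\<lambda>c. c * _"] cong: if_cong\<close>)

text \<open>The indicator functions of the two halves of an interval are half the sum and half the difference
  of its indicator function and of the Haar function that it supports.\<close>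

lemma haar_combination_dyadic:
  assumes "k < 2 ^ j"
  shows "haar_combination (2 ^ j) (indicator (dyadic j k))"
  using assms
proof (induction j arbitrary: k)
  case 0
  then show ?case
    by (auto simp: haar_combination_def haar_sum_def dyadic_eq_atLeastLessThan intro!: exI[of _ "\<lambda>_. 1"])
next
  case (Suc j)
  define l where "l = k div 2"
  have l: "l < 2 ^ j" using Suc.prems by (auto simp: l_def)
  have "haar_combination (2 ^ Suc j) (indicator (dyadic j l))"
    using Suc.IH[OF l] by (rule haar_combination_mono) simp
  moreover have "haar_combination (2 ^ Suc j) (haar (2 ^ j + l))"
    using l by (intro haar_combination_haar) simp
  ultimately have comb: "haar_combination (2 ^ Suc j) (\<lambda>x. 1 / 2 * indicator (dyadic j l) x + c * haar (2 ^ j + l) x)" for c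
    by (rule haar_combination_scale_add)
  have eq: "indicator (dyadic (Suc j) (2 * l)) x = 1 / 2 * indicator (dyadic j l) x + 1 / 2 * haar (2 ^ j + l) x"
    "indicator (dyadic (Suc j) (2 * l + 1)) x = 1 / 2 * indicator (dyadic j l) x + - 1 / 2 * haar (2 ^ j + l) x" for x
    using dyadic_split[of j l] dyadic_disjoint[of "2 * l" "2 * l + 1" "Suc j"]
    by (auto simp: haar_dyadic[OF l] indicator_def)
  consider "k = 2 * l" | "k = 2 * l + 1" unfolding l_def by linarith
  then show ?case
    by cases (use comb[of "1 / 2"] comb[of "- 1 / 2"] in \<open>simp_all only: eq[abs_def]\<close>)
qed

lemma AE_unit_half_open: "AE x in unit_leb. x \<in> {0..<1}"
proof -
  have "AE x in lebesgue. x \<noteq> (1::real)" by (rule AE_completion) (rule AE_lborel_singleton)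
  then have "AE x in lebesgue. x \<in> {0..1} \<longrightarrow> x \<in> {0..<1::real}"
    by eventually_elim auto
  then show ?thesis by (subst AE_restrict_space_iff) auto
qed

definition haar_approximable :: "real \<Rightarrow> (real \<Rightarrow> real) \<Rightarrow> bool" where
  "haar_approximable p f \<longleftrightarrow> (\<forall>e>0. \<exists>a m. modular p (\<lambda>x. f x - haar_sum a m x) < e)"

lemma haar_approximable_limit:
  assumes p: "0 \<le> p" and f: "p_integrable p f" and g: "\<And>i. p_integrable p (g i)"
    and approx: "\<And>i::nat. haar_approximable p (g i)"
    and lim: "(\<lambda>i. modular p (\<lambda>x. f x - g i x)) \<longlonglongrightarrow> 0"
  shows "haar_approximable p f"
  unfolding haar_approximable_def
proof (intro allI impI)
  fix e :: real assume "0 < e"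
  then have e: "0 < e / (2 * 2 powr p)" by simp
  from order_tendstoD(2)[OF lim e] obtain i where i: "modular p (\<lambda>x. f x - g i x) < e / (2 * 2 powr p)"
    by (auto simp: eventually_sequentially)
  obtain a m where a: "modular p (\<lambda>x. g i x - haar_sum a m x) < e / (2 * 2 powr p)"
    using approx[of i] e by (auto simp: haar_approximable_def)
  have "modular p (\<lambda>x. (f x - g i x) + (g i x - haar_sum a m x))
      \<le> 2 powr p * (modular p (\<lambda>x. f x - g i x) + modular p (\<lambda>x. g i x - haar_sum a m x))"
    using p f g by (intro p_integrable_add p_integrable_diff p_integrable_haar_sum)
  also have "\<dots> < 2 powr p * (e / (2 * 2 powr p) + e / (2 * 2 powr p))"
    using i a by (intro mult_strict_left_mono add_strict_mono) auto
  also have "\<dots> = e" by simp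
  finally show "\<exists>a m. modular p (\<lambda>x. f x - haar_sum a m x) < e" by auto
qed

lemma p_integrable_bounded:
  assumes [measurable]: "f \<in> borel_measurable unit_leb" and "0 \<le> p" and b: "\<And>x. \<bar>f x\<bar> \<le> M"
  shows "p_integrable p f"
  unfolding p_integrable_def
proof
  show "integrable unit_leb (\<lambda>x. \<bar>f x\<bar> powr p)"
    by (rule Bochner_Integration.integrable_bound[of _ "\<lambda>x. M powr p"])
      (use powr_mono2[OF \<open>0 \<le> p\<close> _ b] in auto)
qed fact

text \<open>The approximants take on each dyadic interval the value of \<open>g\<close> at the left end point; pointwise
  convergence and a uniform bound suffice.\<close>

lemma haar_approximable_continuous:
  assumes p: "0 < p" and g: "continuous_on UNIV g" and b: "\<And>x. \<bar>g x\<bar> \<le> M"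
  shows "haar_approximable p g"
proof -
  have [measurable]: "g \<in> borel_measurable unit_leb"
    using g continuous_imp_measurable_on_sets_lebesgue[of "{0..1}" g] continuous_on_subset by auto
  define s where "s j x = (\<Sum>k<2 ^ j. g (real k / 2 ^ j) * indicator (dyadic j k) x)" for j x
  have "\<exists>a. \<forall>x\<in>{0..<1}. s j x = haar_sum a (2 ^ j) x" for j
    using haar_combination_sum[of "{..<2 ^ j}" "2 ^ j" "\<lambda>k. indicator (dyadic j k)" "\<lambda>k. g (real k / 2 ^ j)"]
      haar_combination_dyadic unfolding haar_combination_def s_def[abs_def] by auto
  then obtain a where a: "\<And>j x. x \<in> {0..<1} \<Longrightarrow> s j x = haar_sum (a j) (2 ^ j) x" by metis
  have s: "s j x = g (\<lfloor>2 ^ j * x\<rfloor> / 2 ^ j)" if "x \<in> {0..<1}" for j x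
  proof -
    define k where "k = nat \<lfloor>2 ^ j * x\<rfloor>"
    have "real_of_int \<lfloor>2 ^ j * x\<rfloor> \<le> 2 ^ j * x" by linarith
    also have "\<dots> < 2 ^ j" using that by simp
    finally have lt: "\<lfloor>2 ^ j * x\<rfloor> < 2 ^ j" by (metis of_int_less_iff of_int_numeral of_int_power)
    have ge: "0 \<le> \<lfloor>2 ^ j * x\<rfloor>" using that by simp
    have k: "k < 2 ^ j" "int k = \<lfloor>2 ^ j * x\<rfloor>" using ge lt by (auto simp: k_def nat_less_iff)
    have "s j x = (\<Sum>i<2 ^ j. if i = k then g (real k / 2 ^ j) else 0)"
      unfolding s_def using k(2) by (intro sum.cong) (auto simp: dyadic_def)
    also have "\<dots> = g (real k / 2 ^ j)" using k(1) by simp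
    also have "real k = \<lfloor>2 ^ j * x\<rfloor>" using k(2) by (metis of_int_of_nat_eq)
    finally show ?thesis .
  qed
  have lim: "(\<lambda>j. g (\<lfloor>2 ^ j * x\<rfloor> / 2 ^ j)) \<longlonglongrightarrow> g x" for x
  proof -
    have "(\<lambda>j. (1 / 2) ^ j) \<longlonglongrightarrow> (0::real)" by (rule LIMSEQ_power_zero) simp
    then have l: "(\<lambda>j. x - (1 / 2) ^ j) \<longlonglongrightarrow> x - 0" by (intro tendsto_diff tendsto_const)
    have "(\<lambda>j. \<lfloor>2 ^ j * x\<rfloor> / 2 ^ j) \<longlonglongrightarrow> x"
    proof (rule tendsto_sandwich[OF _ _ _ tendsto_const])
      show "(\<lambda>j. x - (1 / 2) ^ j) \<longlonglongrightarrow> x" using l by simp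
      show "\<forall>\<^sub>F j in sequentially. x - (1 / 2) ^ j \<le> \<lfloor>2 ^ j * x\<rfloor> / 2 ^ j"
      proof (intro always_eventually allI)
        fix j :: nat
        have "2 ^ j * x - 1 \<le> \<lfloor>2 ^ j * x\<rfloor>" by linarith
        then have "(2 ^ j * x - 1) / 2 ^ j \<le> \<lfloor>2 ^ j * x\<rfloor> / 2 ^ j" by (rule divide_right_mono) simp
        then show "x - (1 / 2) ^ j \<le> \<lfloor>2 ^ j * x\<rfloor> / 2 ^ j" by (simp add: diff_divide_distrib power_divide)
      qed
      show "\<forall>\<^sub>F j in sequentially. \<lfloor>2 ^ j * x\<rfloor> / 2 ^ j \<le> x"
        by (auto simp: field_simps)
    qed
    moreover have "isCont g x" using g by (simp add: continuous_on_eq_continuous_at)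
    ultimately show ?thesis by (rule isCont_tendsto_compose[rotated])
  qed
  have lim0: "(\<lambda>j. modular p (\<lambda>x. g x - haar_sum (a j) (2 ^ j) x)) \<longlonglongrightarrow> 0"
  proof (rule modular_tendsto_zero[where w = "\<lambda>_. 2 * M"])
    show "(\<lambda>x. g x - haar_sum (a j) (2 ^ j) x) \<in> borel_measurable unit_leb" for j
      by (intro borel_measurable_diff borel_measurable_haar_sum) fact
    show "AE x in unit_leb. (\<lambda>j. g x - haar_sum (a j) (2 ^ j) x) \<longlonglongrightarrow> 0"
      using AE_unit_half_open
    proof eventually_elim
      case (elim x)
      have "(\<lambda>j. g x - g (\<lfloor>2 ^ j * x\<rfloor> / 2 ^ j)) \<longlonglongrightarrow> g x - g x"
        by (intro tendsto_diff tendsto_const lim)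
      then show ?case using s[OF elim] a[OF elim] by simp
    qed
    show "AE x in unit_leb. \<bar>g x - haar_sum (a j) (2 ^ j) x\<bar> \<le> 2 * M" for j
      using AE_unit_half_open
    proof eventually_elim
      case (elim x)
      have "\<bar>g x - g (\<lfloor>2 ^ j * x\<rfloor> / 2 ^ j)\<bar> \<le> 2 * M"
        using b[of x] b[of "\<lfloor>2 ^ j * x\<rfloor> / 2 ^ j"] by linarith
      then show ?case using s[OF elim] a[OF elim] by simp
    qed
  qed (use p in auto)
  show ?thesis unfolding haar_approximable_def
  proof (intro allI impI)
    fix e :: real assume "0 < e"
    from order_tendstoD(2)[OF lim0 this] obtain j where "modular p (\<lambda>x. g x - haar_sum (a j) (2 ^ j) x) < e"
      by (auto simp: eventually_sequentially)
    then show "\<exists>a m. modular p (\<lambda>x. g x - haar_sum a m x) < e" by blast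
  qed
qed

definition truncate :: "real \<Rightarrow> real \<Rightarrow> real" where
  "truncate M y = max (- M) (min M y)"

lemma abs_truncate_le: "0 \<le> M \<Longrightarrow> \<bar>truncate M y\<bar> \<le> M"
  by (auto simp: truncate_def)

lemma truncate_eq: "\<bar>y\<bar> \<le> M \<Longrightarrow> truncate M y = y"
  by (auto simp: truncate_def)

lemma continuous_on_truncate [continuous_intros]:
  "continuous_on A f \<Longrightarrow> continuous_on A (\<lambda>x. truncate M (f x))"
  unfolding truncate_def by (intro continuous_intros)

lemma borel_measurable_truncate [measurable]: "truncate M \<in> borel_measurable borel"
  unfolding truncate_def[abs_def] by measurable

text \<open>A Lebesgue measurable function is almost everywhere a limit of continuous functions, and
  truncation at \<open>M\<close> makes these uniformly bounded without disturbing the limit.\<close>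

lemma haar_approximable_bounded:
  assumes p: "0 < p" and [measurable]: "f \<in> borel_measurable unit_leb"
    and M: "0 \<le> M" and b: "\<And>x. \<bar>f x\<bar> \<le> M"
  shows "haar_approximable p f"
proof -
  have "(\<lambda>x. if x \<in> {0..1} then f x else 0) \<in> borel_measurable lebesgue"
    by (rule borel_measurable_if_I) auto
  then have "(\<lambda>x. if x \<in> {0..1} then f x else 0) measurable_on UNIV"
    by (rule lebesgue_measurable_imp_measurable_on_real) simp
  then have "f measurable_on {0..1}" by (simp only: measurable_on_UNIV)
  then obtain N g where N: "negligible N" and g: "\<And>i. continuous_on UNIV (g i)"
    and lim: "\<And>x. x \<notin> N \<Longrightarrow> (\<lambda>i::nat. g i x) \<longlonglongrightarrow> (if x \<in> {0..1} then f x else 0)"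
    unfolding measurable_on_def by blast
  define h where "h i x = truncate M (g i x)" for i x
  have h: "continuous_on UNIV (h i)" "\<And>x. \<bar>h i x\<bar> \<le> M" for i
    using g M by (auto simp: h_def[abs_def] abs_truncate_le intro!: continuous_intros)
  have [measurable]: "h i \<in> borel_measurable unit_leb" for i
    using h(1)[of i] continuous_imp_measurable_on_sets_lebesgue[of "{0..1}" "h i"] continuous_on_subset by auto
  have "AE x in lebesgue. x \<notin> N"
    using N by (metis AE_iff_null_sets AE_not_in negligible_iff_null_sets)
  then have "AE x in lebesgue. x \<in> {0..1} \<longrightarrow> x \<notin> N"
    by eventually_elim auto
  then have AE: "AE x in unit_leb. x \<notin> N" by (subst AE_restrict_space_iff) auto
  have AE_unit: "AE x in unit_leb. x \<in> {0..1}" by (rule AE_I2) simp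
  show ?thesis
  proof (rule haar_approximable_limit[of p f h])
    show "p_integrable p f" "p_integrable p (h i)" for i
      using p b h by (auto intro!: p_integrable_bounded)
    show "haar_approximable p (h i)" for i
      using p h by (rule haar_approximable_continuous)
    show "(\<lambda>i. modular p (\<lambda>x. f x - h i x)) \<longlonglongrightarrow> 0"
    proof (rule modular_tendsto_zero[where w = "\<lambda>_. 2 * M"])
      show "AE x in unit_leb. (\<lambda>i. f x - h i x) \<longlonglongrightarrow> 0"
        using AE AE_unit
      proof eventually_elim
        case (elim x)
        have "(\<lambda>i. g i x) \<longlonglongrightarrow> f x" using lim[of x] elim by simp
        then have "(\<lambda>i. f x - h i x) \<longlonglongrightarrow> f x - truncate M (f x)"
          unfolding h_def truncate_def by (intro tendsto_intros)
        then show ?case using b[of x] by (simp add: truncate_eq)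
      qed
      show "AE x in unit_leb. \<bar>f x - h i x\<bar> \<le> 2 * M" for i
      proof (rule AE_I2)
        fix x show "\<bar>f x - h i x\<bar> \<le> 2 * M" using b[of x] h(2)[of i x] by linarith
      qed
    qed (use p in auto)
  qed (use p in auto)
qed

theorem haar_sums_dense:
  assumes p: "0 < p" and f: "p_integrable p f"
  shows "haar_approximable p f"
proof -
  have [measurable]: "f \<in> borel_measurable unit_leb" and i: "integrable unit_leb (\<lambda>x. \<bar>f x\<bar> powr p)"
    using f by (auto simp: p_integrable_def)
  define g where "g M x = truncate (real M) (f x)" for M x
  have [measurable]: "g M \<in> borel_measurable unit_leb" for M unfolding g_def[abs_def] by measurable
  have g: "\<bar>g M x\<bar> \<le> real M" for M x by (simp add: g_def abs_truncate_le)
  show ?thesis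
  proof (rule haar_approximable_limit[of p f g])
    show "p_integrable p (g M)" for M using p g by (auto intro!: p_integrable_bounded)
    show "haar_approximable p (g M)" for M
      using p g by (intro haar_approximable_bounded[where M = "real M"]) auto
    show "(\<lambda>M. modular p (\<lambda>x. f x - g M x)) \<longlonglongrightarrow> 0"
    proof (rule modular_tendsto_zero[where w = "\<lambda>x. \<bar>f x\<bar>"])
      show "AE x in unit_leb. (\<lambda>M. f x - g M x) \<longlonglongrightarrow> 0"
      proof (rule AE_I2)
        fix x
        obtain M0 where "\<bar>f x\<bar> \<le> real M0" using real_arch_simple by blast
        then have "\<And>M. M0 \<le> M \<Longrightarrow> f x - g M x = 0" by (simp add: g_def truncate_eq)
        then show "(\<lambda>M. f x - g M x) \<longlonglongrightarrow> 0"
          by (intro tendsto_eventually) (auto simp: eventually_sequentially)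
      qed
      show "AE x in unit_leb. \<bar>f x - g M x\<bar> \<le> \<bar>f x\<bar>" for M
        by (rule AE_I2) (auto simp: g_def truncate_def)
    qed (use p i in auto)
  qed (use p f in auto)
qed

section \<open>The Haar basis\<close>

text \<open>The basis constant: the square function does not decrease when terms are added, and it controls
  the modular from both sides.\<close>

lemma modular_haar_sum_mono:
  assumes p: "2 < p"
  obtains K where "1 \<le> K"
    "\<And>a m m'. m \<le> m' \<Longrightarrow> modular p (haar_sum a m) \<le> K * modular p (haar_sum a m')"
proof -
  obtain K where K: "1 \<le> K"
    "\<And>a m. (LINT x|unit_leb. haar_square a m x powr (p / 2)) \<le> K * modular p (haar_sum a m)"
    "\<And>a m. modular p (haar_sum a m) \<le> K * (LINT x|unit_leb. haar_square a m x powr (p / 2))"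
    using haar_square_function_equivalence[OF p] unfolding modular_def by metis
  show ?thesis
  proof
    show "1 \<le> K * K" using mult_mono[OF K(1) K(1)] K(1) by simp
    fix a and m m' :: nat assume "m \<le> m'"
    have "modular p (haar_sum a m) \<le> K * (LINT x|unit_leb. haar_square a m x powr (p / 2))" by (rule K)
    also have "\<dots> \<le> K * (LINT x|unit_leb. haar_square a m' x powr (p / 2))"
      using K(1) p \<open>m \<le> m'\<close> integrable_haar_pair[of "\<lambda>f s. s powr (p / 2)"]
      by (intro mult_left_mono integral_mono powr_mono2 haar_square_mono haar_square_nonneg) auto
    also have "\<dots> \<le> K * (K * modular p (haar_sum a m'))"
      using K by (intro mult_left_mono) auto
    finally show "modular p (haar_sum a m) \<le> K * K * modular p (haar_sum a m')" by simp
  qed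
qed

lemma le_if_le_plus_epsilon:
  fixes A B D :: real
  assumes "\<And>e. 0 < e \<Longrightarrow> A \<le> B + D * e"
  shows "A \<le> B"
proof -
  have "((\<lambda>e. B + D * e) \<longlongrightarrow> B + D * 0) (at_right 0)" by (intro tendsto_intros)
  moreover have "\<forall>\<^sub>F e in at_right 0. A \<le> B + D * e"
    using assms by (auto simp: eventually_at_filter)
  ultimately have "A \<le> B + D * 0" by (rule tendsto_lowerbound) simp
  then show ?thesis by simp
qed

lemma haar_projection_diff:
  assumes "integrable unit_leb f" "integrable unit_leb g"
  shows "haar_sum (haar_coeff (\<lambda>x. f x - g x)) m x = haar_sum (haar_coeff f) m x - haar_sum (haar_coeff g) m x"
  by (simp add: haar_sum_def haar_coeff_diff[OF assms] left_diff_distrib sum_subtractf)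

lemma haar_projection_haar_sum:
  assumes "N \<le> m"
  shows "haar_sum (haar_coeff (haar_sum a N)) m = haar_sum a N"
proof -
  have eq: "haar_coeff (haar_sum a N) = (\<lambda>n. if n < N then a n else 0)"
    by (simp add: haar_coeff_haar_sum fun_eq_iff)
  show ?thesis unfolding eq by (rule ext) (rule haar_sum_truncate[OF assms])
qed

text \<open>For Haar sums this is the bound above. A general \<open>f\<close> is approximated by a Haar sum; the crude bound
  disposes of the remainder, since its constant may depend on \<open>m\<close> but multiplies an arbitrarily
  small number.\<close>

lemma modular_haar_projection:
  assumes p: "2 < p"
  obtains K where "0 \<le> K"
    "\<And>f m. p_integrable p f \<Longrightarrow> modular p (haar_sum (haar_coeff f) m) \<le> K * modular p f"
proof -
  obtain K where K: "1 \<le> K"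
    "\<And>a m m'. m \<le> m' \<Longrightarrow> modular p (haar_sum a m) \<le> K * modular p (haar_sum a m')"
    using modular_haar_sum_mono[OF p] by blast
  have p0: "0 \<le> p" "1 < p" using p by auto
  show ?thesis
  proof
    show "0 \<le> 2 powr p * K * 2 powr p" using K by simp
    fix f m assume f: "p_integrable p f"
    obtain D where D: "0 \<le> D" "\<And>f. p_integrable p f \<Longrightarrow> modular p (haar_sum (haar_coeff f) m) \<le> D * modular p f"
      using modular_haar_projection_crude[OF p0(2)] by blast
    show "modular p (haar_sum (haar_coeff f) m) \<le> 2 powr p * K * 2 powr p * modular p f"
    proof (rule le_if_le_plus_epsilon)
      fix e :: real assume "0 < e"
      then obtain a N where a: "modular p (\<lambda>x. f x - haar_sum a N x) < e"
        using haar_sums_dense[OF _ f] p unfolding haar_approximable_def by auto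
      let ?v = "haar_sum a N" and ?M = "max m N"
      let ?w = "\<lambda>x. f x - ?v x"
      have w: "p_integrable p ?w" using p0 f by (intro p_integrable_diff p_integrable_haar_sum)
      have split: "haar_sum (haar_coeff f) m x - haar_sum (haar_coeff ?v) m x = haar_sum (haar_coeff ?w) m x" for x
        using haar_projection_diff[OF integrable_p_integrable[OF p0(2) f] integrable_p_integrable[OF p0(2) p_integrable_haar_sum], of a N m x]
        by simp
      have "modular p (haar_sum (haar_coeff ?v) m) \<le> K * modular p (haar_sum (haar_coeff ?v) ?M)"
        by (rule K) simp
      also have "haar_sum (haar_coeff ?v) ?M = ?v"
        by (rule haar_projection_haar_sum) simp
      also have "modular p ?v \<le> 2 powr p * (modular p f + e)"
      proof -
        have "modular p ?v \<le> 2 powr p * (modular p f + modular p (\<lambda>x. ?v x - f x))"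
          using p0 f by (intro modular_triangle p_integrable_haar_sum)
        also have "modular p (\<lambda>x. ?v x - f x) \<le> e" using a by (subst modular_minus_commute) simp
        finally show ?thesis by simp
      qed
      finally have v: "modular p (haar_sum (haar_coeff ?v) m) \<le> K * (2 powr p * (modular p f + e))"
        using K by (simp add: mult_left_mono)
      have "modular p (haar_sum (haar_coeff ?w) m) \<le> D * modular p ?w" by (rule D(2)[OF w])
      also have "\<dots> \<le> D * e" using D(1) a by (intro mult_left_mono) auto
      finally have w': "modular p (haar_sum (haar_coeff ?w) m) \<le> D * e" .
      have "modular p (haar_sum (haar_coeff f) m) \<le> 2 powr p *
         (modular p (haar_sum (haar_coeff ?v) m) + modular p (\<lambda>x. haar_sum (haar_coeff f) m x - haar_sum (haar_coeff ?v) m x))"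
        using p0 by (intro modular_triangle p_integrable_haar_sum)
      also have "\<dots> \<le> 2 powr p * (K * (2 powr p * (modular p f + e)) + D * e)"
        unfolding split using v w' by (intro mult_left_mono add_mono) auto
      finally show "modular p (haar_sum (haar_coeff f) m) \<le> 2 powr p * K * 2 powr p * modular p f
        + (2 powr p * K * 2 powr p + 2 powr p * D) * e"
        by (simp add: algebra_simps)
    qed
  qed
qed

text \<open>A Haar sum \<open>v\<close> close to \<open>f\<close> is reproduced by all late projections, so the error is that of
  \<open>f - v\<close>, which the uniform bound keeps small.\<close>

lemma haar_expansion_converges:
  assumes p: "2 < p" and f: "p_integrable p f"
  shows "(\<lambda>m. modular p (\<lambda>x. f x - haar_sum (haar_coeff f) m x)) \<longlonglongrightarrow> 0"
proof -
  obtain K where K: "0 \<le> K"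
    "\<And>f m. p_integrable p f \<Longrightarrow> modular p (haar_sum (haar_coeff f) m) \<le> K * modular p f"
    using modular_haar_projection[OF p] by blast
  have p0: "0 \<le> p" "1 < p" using p by auto
  show ?thesis
  proof (rule tendstoI)
    fix e :: real assume e: "0 < e"
    define d where "d = e / (2 powr p * (1 + K))"
    have d: "0 < d" using e K by (simp add: d_def)
    obtain a N where a: "modular p (\<lambda>x. f x - haar_sum a N x) < d"
      using haar_sums_dense[OF _ f] p d unfolding haar_approximable_def by auto
    let ?v = "haar_sum a N"
    let ?w = "\<lambda>x. f x - ?v x"
    have w: "p_integrable p ?w" using p0 f by (intro p_integrable_diff p_integrable_haar_sum)
    have "modular p (\<lambda>x. f x - haar_sum (haar_coeff f) m x) < e" if "N \<le> m" for m
    proof -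
      have eq: "f x - haar_sum (haar_coeff f) m x = ?w x - haar_sum (haar_coeff ?w) m x" for x
        using haar_projection_diff[OF integrable_p_integrable[OF p0(2) f] integrable_p_integrable[OF p0(2) p_integrable_haar_sum], of a N m x]
          haar_projection_haar_sum[OF that, of a] by simp
      have "modular p (\<lambda>x. f x - haar_sum (haar_coeff f) m x)
          \<le> 2 powr p * (modular p ?w + modular p (haar_sum (haar_coeff ?w) m))"
        unfolding eq by (rule p_integrable_diff(2)[OF p0(1) w p_integrable_haar_sum])
      also have "\<dots> \<le> 2 powr p * (modular p ?w + K * modular p ?w)"
        using K(2)[OF w] by (intro mult_left_mono add_left_mono) auto
      also have "\<dots> = 2 powr p * (1 + K) * modular p ?w" by (simp add: algebra_simps)
      also have "\<dots> < 2 powr p * (1 + K) * d" using a K by (intro mult_strict_left_mono) auto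
      also have "\<dots> = e" using K by (simp add: d_def)
      finally show ?thesis .
    qed
    then show "\<forall>\<^sub>F m in sequentially. dist (modular p (\<lambda>x. f x - haar_sum (haar_coeff f) m x)) 0 < e"
      by (auto simp: eventually_sequentially modular_nonneg)
  qed
qed

text \<open>Each coefficient is a continuous functional, and on late partial sums its value is \<open>a n\<close>.\<close>

lemma haar_expansion_unique:
  assumes p: "1 < p" and f: "p_integrable p f"
    and lim: "(\<lambda>m. modular p (\<lambda>x. f x - haar_sum a m x)) \<longlonglongrightarrow> 0"
  shows "a = haar_coeff f"
proof
  fix n
  let ?c = "LINT x|unit_leb. (haar n x)\<^sup>2"
  have c: "0 < ?c" by (rule integral_haar_power2_pos)
  have "(?c * \<bar>haar_coeff f n - a n\<bar>) powr p \<le> modular p (\<lambda>x. f x - haar_sum a m x)" if "n < m" for m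
  proof -
    let ?w = "\<lambda>x. f x - haar_sum a m x"
    have w: "p_integrable p ?w" using p f by (intro p_integrable_diff p_integrable_haar_sum) auto
    have "haar_coeff f n - a n = haar_coeff ?w n"
      using haar_coeff_diff[OF integrable_p_integrable[OF p f] integrable_p_integrable[OF p p_integrable_haar_sum], of a m n] that
      by (simp add: haar_coeff_haar_sum)
    then have "?c * \<bar>haar_coeff f n - a n\<bar> \<le> (LINT x|unit_leb. \<bar>?w x\<bar>)"
      using abs_haar_coeff_le[OF integrable_p_integrable[OF p w], of n] c by (simp add: field_simps)
    then have "(?c * \<bar>haar_coeff f n - a n\<bar>) powr p \<le> (LINT x|unit_leb. \<bar>?w x\<bar>) powr p"
      using p c by (intro powr_mono2) auto
    also have "\<dots> \<le> modular p ?w" by (rule integral_abs_le_modular[OF p w])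
    finally show ?thesis .
  qed
  then have "\<forall>\<^sub>F m in sequentially. (?c * \<bar>haar_coeff f n - a n\<bar>) powr p \<le> modular p (\<lambda>x. f x - haar_sum a m x)"
    by (auto simp: eventually_sequentially intro!: exI[of _ "Suc n"])
  then have "(?c * \<bar>haar_coeff f n - a n\<bar>) powr p \<le> 0"
    by (rule tendsto_lowerbound[OF lim]) simp
  then show "a n = haar_coeff f n" using c by simp
qed

definition haar_class :: "nat \<Rightarrow> mclass" where
  "haar_class n = abs_mclass (haar n)"

lemma Lp_representative:
  assumes "u \<in> Lp p"
  obtains f where "p_integrable p f" "u = abs_mclass f"
proof
  have u: "u = abs_mclass (rep_mclass u)" by (simp add: Quotient_abs_rep[OF Quotient_mclass])
  have e: "ae_equal (rep_mclass u) (rep_mclass u)" by (rule Quotient_rep_reflp[OF Quotient_mclass])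
  have "in_Lp p (abs_mclass (rep_mclass u))" using assms u by (simp add: Lp_def)
  then show "p_integrable p (rep_mclass u)" using e by (simp add: in_Lp.abs_eq p_integrable_def ae_equal_def)
  show "u = abs_mclass (rep_mclass u)" by (fact u)
qed

lemma ae_equal_refl: "f \<in> borel_measurable unit_leb \<Longrightarrow> ae_equal f f"
  by (simp add: ae_equal_def)

lemma haar_class_in_Lp: "haar_class n \<in> Lp p"
  using p_integrable_simple[OF simple_function_haar, of p n]
  by (simp add: Lp_def haar_class_def in_Lp.abs_eq ae_equal_refl p_integrable_def)

lemma sum_haar_class: "(\<Sum>n<m. a n *\<^sub>R haar_class n) = abs_mclass (haar_sum a m)"
proof (induction m)
  case 0
  then show ?case by (simp add: zero_mclass_def haar_sum_def[abs_def])
next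
  case (Suc m)
  have "(\<Sum>n<Suc m. a n *\<^sub>R haar_class n) = abs_mclass (haar_sum a m) + a m *\<^sub>R abs_mclass (haar m)"
    using Suc by (simp add: haar_class_def)
  also have "\<dots> = abs_mclass (haar_sum a (Suc m))"
    by (simp add: scaleR_mclass.abs_eq plus_mclass.abs_eq ae_equal_refl borel_measurable_haar_sum haar_sum_def[abs_def])
  finally show ?case .
qed

lemma Lp_norm_abs_mclass:
  assumes "f \<in> borel_measurable unit_leb"
  shows "Lp_norm p (abs_mclass f) = modular p f powr (1 / p)"
  using assms by (simp add: Lp_norm.abs_eq ae_equal_refl modular_def)

lemma expansion_haar_class:
  assumes p: "0 < p" and f: "f \<in> borel_measurable unit_leb"
  shows "expansion (Lp_norm p) haar_class a (abs_mclass f)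
     \<longleftrightarrow> (\<lambda>m. modular p (\<lambda>x. f x - haar_sum a m x)) \<longlonglongrightarrow> 0"
proof -
  have "Lp_norm p (abs_mclass f - (\<Sum>n<m. a n *\<^sub>R haar_class n))
     = modular p (\<lambda>x. f x - haar_sum a m x) powr (1 / p)" for m
    using f by (simp add: sum_haar_class minus_mclass.abs_eq ae_equal_refl borel_measurable_haar_sum
        Lp_norm_abs_mclass borel_measurable_diff)
  then have "expansion (Lp_norm p) haar_class a (abs_mclass f)
     \<longleftrightarrow> (\<lambda>m. modular p (\<lambda>x. f x - haar_sum a m x) powr (1 / p)) \<longlonglongrightarrow> 0"
    by (simp add: expansion_def)
  also have "\<dots> \<longleftrightarrow> (\<lambda>m. modular p (\<lambda>x. f x - haar_sum a m x)) \<longlonglongrightarrow> 0" (is "?L \<longleftrightarrow> ?R")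
  proof
    assume ?L
    then have "(\<lambda>m. (modular p (\<lambda>x. f x - haar_sum a m x) powr (1 / p)) powr p) \<longlonglongrightarrow> 0 powr p"
      using p by (intro tendsto_powr') auto
    then show ?R using p by (simp add: powr_powr modular_nonneg)
  next
    assume ?R
    then have "(\<lambda>m. modular p (\<lambda>x. f x - haar_sum a m x) powr (1 / p)) \<longlonglongrightarrow> 0 powr (1 / p)"
      using p by (intro tendsto_powr') (auto simp: modular_nonneg)
    then show ?L by simp
  qed
  finally show ?thesis .
qed

theorem schauder_basis_haar:
  assumes p: "2 < p"
  shows "schauder_basis (Lp p) (Lp_norm p) haar_class"
  unfolding schauder_basis_def
proof (intro conjI ballI)
  show "range haar_class \<subseteq> Lp p" using haar_class_in_Lp by auto
  fix u assume "u \<in> Lp p"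
  then obtain f where f: "p_integrable p f" "u = abs_mclass f" by (rule Lp_representative)
  have iff: "expansion (Lp_norm p) haar_class a u \<longleftrightarrow> (\<lambda>m. modular p (\<lambda>x. f x - haar_sum a m x)) \<longlonglongrightarrow> 0" for a
    using f p by (simp add: expansion_haar_class p_integrable_def)
  have "1 < p" using p by simp
  show "\<exists>!a. expansion (Lp_norm p) haar_class a u"
    unfolding iff
  proof (rule ex1I)
    show "(\<lambda>m. modular p (\<lambda>x. f x - haar_sum (haar_coeff f) m x)) \<longlonglongrightarrow> 0"
      by (rule haar_expansion_converges[OF p f(1)])
  qed (rule haar_expansion_unique[OF \<open>1 < p\<close> f(1)])
qed

section \<open>Weights from the dual unit ball\<close>

text \<open>Strict positivity keeps all weights positive.\<close>

definition dual_density :: "real \<Rightarrow> (real \<Rightarrow> real) \<Rightarrow> bool" where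
  "dual_density q g \<longleftrightarrow> p_integrable q g \<and> (\<forall>x. 0 < g x) \<and> modular q g \<le> 1"

text \<open>With these weights \<open>\<Sum> a\<^sub>n\<^sup>2 w\<^sub>n\<^sup>2\<close> is the integral against \<open>g\<close> of the squared
  square function of \<open>\<Sum> a\<^sub>n h\<^sub>n\<close>.\<close>

definition haar_weight :: "(real \<Rightarrow> real) \<Rightarrow> nat \<Rightarrow> real" where
  "haar_weight g n = sqrt (LINT x|unit_leb. g x * (haar n x)\<^sup>2)"

lemma integrable_mult_bounded:
  assumes g: "integrable unit_leb g" and s: "simple_function unit_leb s"
  shows "integrable unit_leb (\<lambda>x. g x * s x :: real)"
proof -
  have [measurable]: "s \<in> borel_measurable unit_leb" "g \<in> borel_measurable unit_leb"
    using s g by (auto intro: borel_measurable_simple_function)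
  have "finite (s ` {0..1})" using s by (auto simp: simple_function_def)
  then have "bounded (s ` {0..1})" by (rule finite_imp_bounded)
  then obtain M where M: "\<forall>y\<in>s ` {0..1}. norm y \<le> M" by (auto simp: bounded_iff)
  show ?thesis
  proof (rule Bochner_Integration.integrable_bound)
    show "integrable unit_leb (\<lambda>x. M * g x)" using g by simp
    show "AE x in unit_leb. norm (g x * s x) \<le> norm (M * g x)"
    proof (rule AE_I2)
      fix x assume "x \<in> space unit_leb"
      then have "norm (s x) \<le> M" using M by simp
      then have "\<bar>s x\<bar> \<le> \<bar>M\<bar>" by simp
      then show "norm (g x * s x) \<le> norm (M * g x)"
        by (simp add: abs_mult mult.commute[of "\<bar>M\<bar>"] mult_left_mono)
    qed
  qed measurable
qed

lemma simple_function_haar_power2: "simple_function unit_leb (\<lambda>x. (haar n x)\<^sup>2)"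
  unfolding power2_eq_square by (intro simple_function_mult simple_function_haar)

lemma dual_density_integrable:
  assumes "1 < q" "dual_density q g"
  shows "integrable unit_leb g"
  using assms(2) by (intro integrable_p_integrable[OF assms(1)]) (simp add: dual_density_def)

lemma dual_density_integral_le_1:
  assumes q: "1 < q" and g: "dual_density q g"
  shows "(LINT x|unit_leb. g x) \<le> 1"
proof (rule ccontr)
  assume "\<not> ?thesis"
  then have "1 < (LINT x|unit_leb. g x) powr q"
    using powr_less_mono2[of q 1 "LINT x|unit_leb. g x"] q by simp
  also have "(LINT x|unit_leb. g x) = (LINT x|unit_leb. \<bar>g x\<bar>)"
    using g by (intro Bochner_Integration.integral_cong) (auto simp: dual_density_def less_imp_le)
  also have "\<dots> powr q \<le> modular q g" using g by (intro integral_abs_le_modular[OF q]) (auto simp: dual_density_def)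
  also have "\<dots> \<le> 1" using g by (auto simp: dual_density_def)
  finally show False by simp
qed

lemma haar_weight_bounds:
  assumes q: "1 < q" and g: "dual_density q g"
  shows "0 < haar_weight g n" "haar_weight g n \<le> 1"
proof -
  have pos: "\<And>x. 0 < g x" using g by (auto simp: dual_density_def)
  note gi = dual_density_integrable[OF q g]
  have i: "integrable unit_leb (\<lambda>x. g x * (haar n x)\<^sup>2)"
    by (intro integrable_mult_bounded gi simple_function_haar_power2)
  have "(LINT x|unit_leb. g x * (haar n x)\<^sup>2) \<le> (LINT x|unit_leb. g x)"
    using i gi pos haar_power2_le_one[of n] by (intro integral_mono) (auto intro!: mult_left_le less_imp_le)
  with dual_density_integral_le_1[OF q g] show "haar_weight g n \<le> 1" by (simp add: haar_weight_def)
  have nonneg: "0 \<le> (LINT x|unit_leb. g x * (haar n x)\<^sup>2)"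
    using pos by (intro integral_nonneg_AE AE_I2 mult_nonneg_nonneg) (auto intro: less_imp_le)
  have "(LINT x|unit_leb. g x * (haar n x)\<^sup>2) \<noteq> 0"
  proof
    assume "(LINT x|unit_leb. g x * (haar n x)\<^sup>2) = 0"
    then have "AE x in unit_leb. g x * (haar n x)\<^sup>2 = 0"
      using pos by (subst (asm) integral_nonneg_eq_0_iff_AE[OF i])
        (auto intro!: AE_I2 mult_nonneg_nonneg less_imp_le[OF pos])
    then have "AE x in unit_leb. (haar n x)\<^sup>2 = 0"
    proof eventually_elim
      case (elim x)
      then show ?case using pos[of x] by simp
    qed
    then have "(LINT x|unit_leb. (haar n x)\<^sup>2) = 0" by (rule integral_eq_zero_AE)
    then show False using integral_haar_power2_pos[of n] by simp
  qed
  with nonneg show "0 < haar_weight g n" by (simp add: haar_weight_def)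
qed

lemma sum_haar_weight:
  assumes q: "1 < q" and g: "dual_density q g"
  shows "(\<Sum>n<m. (a n)\<^sup>2 * (haar_weight g n)\<^sup>2) = (LINT x|unit_leb. g x * haar_square a m x)"
proof -
  have pos: "\<And>x. 0 < g x" using g by (auto simp: dual_density_def)
  have i: "integrable unit_leb (\<lambda>x. g x * (haar n x)\<^sup>2)" for n
    by (intro integrable_mult_bounded dual_density_integrable[OF q g] simple_function_haar_power2)
  have "(haar_weight g n)\<^sup>2 = (LINT x|unit_leb. g x * (haar n x)\<^sup>2)" for n
    unfolding haar_weight_def using pos
    by (intro real_sqrt_pow2 integral_nonneg_AE AE_I2 mult_nonneg_nonneg) (auto intro: less_imp_le)
  then have "(\<Sum>n<m. (a n)\<^sup>2 * (haar_weight g n)\<^sup>2)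
      = (\<Sum>n<m. LINT x|unit_leb. (a n)\<^sup>2 * (g x * (haar n x)\<^sup>2))"
    by (simp only: integral_mult_right_zero)
  also have "\<dots> = (LINT x|unit_leb. (\<Sum>n<m. (a n)\<^sup>2 * (g x * (haar n x)\<^sup>2)))"
    by (intro Bochner_Integration.integral_sum[symmetric] integrable_mult_right i)
  also have "\<dots> = (LINT x|unit_leb. g x * haar_square a m x)"
    by (simp only: haar_square_def sum_distrib_left mult.left_commute)
  finally show ?thesis .
qed

text \<open>Hoelder's inequality, from Young's inequality for \<open>s / u\<close> and \<open>g\<close>. A number \<open>u\<close> strictly above \<open>t\<close>
  avoids a separate treatment of \<open>t = 0\<close>.\<close>

lemma dual_density_upper:
  assumes r: "1 < r" and q: "q = r / (r - 1)" and g: "dual_density q g"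
    and s: "simple_function unit_leb s" "\<And>x. 0 \<le> s x"
    and t: "0 \<le> t" "(LINT x|unit_leb. s x powr r) \<le> t powr r"
  shows "(LINT x|unit_leb. g x * s x) \<le> t"
proof -
  have q1: "1 < q" "1 / r + 1 / q = 1" using r by (auto simp: q field_simps)
  have pos: "\<And>x. 0 < g x" using g by (auto simp: dual_density_def)
  have gi: "integrable unit_leb (\<lambda>x. g x powr q)" "(LINT x|unit_leb. g x powr q) \<le> 1"
    using g less_imp_le[OF pos] by (auto simp: dual_density_def p_integrable_def modular_def)
  have si: "integrable unit_leb (\<lambda>x. s x powr r)"
    by (rule integrable_simple[OF simple_function_compose1[OF s(1)]])
  have *: "(LINT x|unit_leb. g x * s x) \<le> u" if "t < u" for u
  proof -
    have u: "0 < u" using t that by simp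
    have "(LINT x|unit_leb. s x powr r) \<le> u powr r"
      using t that r powr_mono2[of r t u] by simp
    then have "(LINT x|unit_leb. (s x / u) powr r) \<le> 1"
      using u by (simp add: powr_divide)
    then have le: "(LINT x|unit_leb. (s x / u) powr r) / r + (LINT x|unit_leb. g x powr q) / q \<le> 1 / r + 1 / q"
      using gi r q1 by (intro add_mono divide_right_mono) auto
    have "(LINT x|unit_leb. g x * s x / u) \<le> (LINT x|unit_leb. (s x / u) powr r / r + g x powr q / q)"
    proof (intro integral_mono)
      show "integrable unit_leb (\<lambda>x. g x * s x / u)"
        using integrable_mult_bounded[OF dual_density_integrable[OF q1(1) g] s(1)] by simp
      show "integrable unit_leb (\<lambda>x. (s x / u) powr r / r + g x powr q / q)"
        using gi si u by (simp add: powr_divide)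
      show "g x * s x / u \<le> (s x / u) powr r / r + g x powr q / q" for x
        using Youngs_inequality[OF r q1, of "s x / u" "g x"] u s(2)[of x] pos[of x] by (simp add: mult.commute)
    qed
    also have "\<dots> = (LINT x|unit_leb. (s x / u) powr r) / r + (LINT x|unit_leb. g x powr q) / q"
      using gi si u by (simp add: powr_divide)
    also have "\<dots> \<le> 1" using le q1 by simp
    finally show ?thesis using u by simp
  qed
  then show ?thesis by (rule dense_ge)
qed

lemma dual_density_one: "dual_density q (\<lambda>_. 1)"
  by (simp add: dual_density_def modular_def p_integrable_def)

text \<open>The extremal function in the duality of \<open>L\<^sub>r\<close> and \<open>L\<^sub>q\<close> is \<open>s\<^sup>r\<^sup>-\<^sup>1\<close>, suitably scaled. It may vanish,
  so it is formed from \<open>z = s + T / 2\<close> instead, where \<open>T\<close> is the norm of \<open>s\<close> in \<open>L\<^sub>r\<close>. As \<open>g\<close> has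
  integral at most \<open>1\<close>, the shift costs at most \<open>T / 2\<close>, which accounts for the factor \<open>2\<close>.\<close>

lemma dual_density_norming:
  assumes r: "1 < r" and q: "q = r / (r - 1)"
    and s: "simple_function unit_leb s" "\<And>x. 0 \<le> s x"
  obtains g where "dual_density q g"
    "(LINT x|unit_leb. s x powr r) \<le> (2 * (LINT x|unit_leb. g x * s x)) powr r"
proof (cases "(LINT x|unit_leb. s x powr r) = 0")
  case True
  then show ?thesis using that[OF dual_density_one] by simp
next
  case False
  define T where "T = (LINT x|unit_leb. s x powr r) powr (1 / r)"
  have T0: "0 \<le> (LINT x|unit_leb. s x powr r)" by (intro integral_nonneg_AE) auto
  have T: "0 < T" and Tr: "T powr r = (LINT x|unit_leb. s x powr r)"
    using False T0 r by (simp_all add: T_def powr_powr)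
  have q1: "1 < q" "(r - 1) * q = r" using r by (auto simp: q field_simps)
  define z where "z x = s x + T / 2" for x
  have z: "simple_function unit_leb z" "\<And>x. 0 < z x"
    unfolding z_def[abs_def] using s T by (auto intro!: simple_function_add add_nonneg_pos)
  have zi: "integrable unit_leb (\<lambda>x. F (z x))" for F :: "real \<Rightarrow> real"
    by (rule integrable_simple[OF simple_function_compose1[OF z(1)]])
  define Z where "Z = (LINT x|unit_leb. z x powr r) powr (1 / r)"
  have "(LINT x|unit_leb. s x powr r) \<le> (LINT x|unit_leb. z x powr r)"
    using s T r
    by (intro integral_mono zi powr_mono2 integrable_simple[OF simple_function_compose1[OF s(1)]]) (auto simp: z_def)
  then have TZ: "T \<le> Z" and Zr: "Z powr r = (LINT x|unit_leb. z x powr r)"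
    using T0 r by (auto simp: Z_def T_def powr_powr intro: powr_mono2)
  have Z: "0 < Z" using T TZ by simp
  define g where "g x = z x powr (r - 1) / Z powr (r - 1)" for x
  have g0: "\<And>x. 0 < g x" using z Z by (simp add: g_def less_imp_neq[symmetric])
  have "g x powr q = z x powr r / Z powr r" for x
    using q1 by (simp add: g_def powr_divide powr_powr)
  then have "modular q g = 1"
    using less_imp_le[OF g0] Z by (simp add: modular_def Zr[symmetric])
  moreover have "simple_function unit_leb g"
    unfolding g_def[abs_def] by (rule simple_function_compose1[OF z(1)])
  ultimately have g: "dual_density q g"
    using g0 by (auto simp: dual_density_def intro: p_integrable_simple)
  have gi: "integrable unit_leb g" by (rule dual_density_integrable[OF q1(1) g])
  have "(LINT x|unit_leb. g x * z x) = (LINT x|unit_leb. z x powr r / Z powr (r - 1))"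
    by (simp add: g_def mult.commute mult_powr_diff_one[OF less_imp_le[OF z(2)]])
  also have "\<dots> = Z powr r / Z powr (r - 1)" by (simp add: Zr)
  also have "\<dots> = Z" using Z mult_powr_diff_one[of Z r] by (simp add: field_simps)
  finally have "(LINT x|unit_leb. g x * z x) = Z" .
  moreover have "(LINT x|unit_leb. g x * z x) = (LINT x|unit_leb. g x * s x) + T / 2 * (LINT x|unit_leb. g x)"
    using gi integrable_mult_bounded[OF gi s(1)] by (simp add: z_def distrib_left)
  moreover have "T / 2 * (LINT x|unit_leb. g x) \<le> T / 2 * 1"
    using T dual_density_integral_le_1[OF q1(1) g] by (intro mult_left_mono) auto
  ultimately have "T \<le> 2 * (LINT x|unit_leb. g x * s x)" using TZ by linarith
  then have "T powr r \<le> (2 * (LINT x|unit_leb. g x * s x)) powr r"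
    using T r by (intro powr_mono2) auto
  then show ?thesis using that[OF g] Tr by simp
qed

section \<open>The norm given by the weights\<close>

lemma epowr_ennreal: "0 \<le> x \<Longrightarrow> epowr (ennreal x) r = ennreal (x powr r)"
  by (simp add: epowr_def)

lemma epowr_mono:
  assumes "0 \<le> r" "t \<le> t'"
  shows "epowr t r \<le> epowr t' r"
proof (cases "t' = \<infinity>")
  case False
  then have "t' < top" "t < top" using assms(2) by (auto simp: less_top[symmetric] top_unique)
  then show ?thesis using assms by (auto simp: epowr_def intro!: ennreal_leI powr_mono2 enn2real_mono)
qed (auto simp: epowr_def)

lemma epowr_epowr: "epowr (epowr t r) r' = epowr t (r * r')"
  by (auto simp: epowr_def powr_powr)

lemma pw_norm1_single_block:
  assumes "0 < p"
  shows "pw_norm1 p {UNIV} W a = epowr (\<Sum>\<^sub>\<infinity>j. ennreal ((a j)\<^sup>2 * (W j)\<^sup>2)) (1 / 2)"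
  using assms by (simp add: pw_norm1_def epowr_epowr)

lemma pw_norm1_single_block_lower:
  assumes "0 < p"
  shows "ennreal (sqrt (\<Sum>j<m. (a j)\<^sup>2 * (W j)\<^sup>2)) \<le> pw_norm1 p {UNIV} W a"
proof -
  have nonneg: "0 \<le> (\<Sum>j<m. (a j)\<^sup>2 * (W j)\<^sup>2)" by (intro sum_nonneg) auto
  have "ennreal (\<Sum>j<m. (a j)\<^sup>2 * (W j)\<^sup>2) = (\<Sum>j<m. ennreal ((a j)\<^sup>2 * (W j)\<^sup>2))"
    by (simp add: sum_ennreal)
  also have "\<dots> = (\<Sum>\<^sub>\<infinity>j\<in>{..<m}. ennreal ((a j)\<^sup>2 * (W j)\<^sup>2))" by simp
  also have "\<dots> \<le> (\<Sum>\<^sub>\<infinity>j. ennreal ((a j)\<^sup>2 * (W j)\<^sup>2))"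
    by (intro infsum_mono_neutral nonneg_summable_on_complete) auto
  finally have "epowr (ennreal (\<Sum>j<m. (a j)\<^sup>2 * (W j)\<^sup>2)) (1 / 2) \<le> pw_norm1 p {UNIV} W a"
    unfolding pw_norm1_single_block[OF assms] by (intro epowr_mono) auto
  then show ?thesis using nonneg by (simp add: epowr_ennreal powr_half_sqrt)
qed

lemma pw_norm1_single_block_upper:
  assumes p: "0 < p" and "0 \<le> D" and le: "\<And>m. (\<Sum>j<m. (a j)\<^sup>2 * (W j)\<^sup>2) \<le> D\<^sup>2"
  shows "pw_norm1 p {UNIV} W a \<le> ennreal D"
proof -
  have "(\<Sum>\<^sub>\<infinity>j. ennreal ((a j)\<^sup>2 * (W j)\<^sup>2)) \<le> ennreal (D\<^sup>2)"
  proof (rule infsum_le_finite_sums)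
    fix G :: "nat set" assume "finite G"
    then obtain m where m: "G \<subseteq> {..<m}" by (auto simp: finite_nat_iff_bounded)
    have "(\<Sum>j\<in>G. ennreal ((a j)\<^sup>2 * (W j)\<^sup>2)) = ennreal (\<Sum>j\<in>G. (a j)\<^sup>2 * (W j)\<^sup>2)"
      by (simp add: sum_ennreal)
    also have "\<dots> \<le> ennreal (D\<^sup>2)"
      using m le[of m] sum_mono2[OF _ m, of "\<lambda>j. (a j)\<^sup>2 * (W j)\<^sup>2"]
      by (intro ennreal_leI) auto
    finally show "(\<Sum>j\<in>G. ennreal ((a j)\<^sup>2 * (W j)\<^sup>2)) \<le> ennreal (D\<^sup>2)" .
  qed (simp add: nonneg_summable_on_complete)
  then have "pw_norm1 p {UNIV} W a \<le> epowr (ennreal (D\<^sup>2)) (1 / 2)"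
    unfolding pw_norm1_single_block[OF p] by (intro epowr_mono) auto
  also have "\<dots> = ennreal D" using \<open>0 \<le> D\<close> by (simp add: epowr_ennreal powr_half_sqrt)
  finally show ?thesis .
qed

definition haar_pw_family :: "real \<Rightarrow> (nat set set \<times> (nat \<Rightarrow> real)) set" where
  "haar_pw_family q = (\<lambda>g. ({UNIV}, haar_weight g)) ` {g. dual_density q g}"

lemma pw_family_haar:
  assumes "1 < q"
  shows "pw_family (haar_pw_family q)"
  unfolding pw_family_def
proof (intro conjI)
  show "haar_pw_family q \<noteq> {}" using dual_density_one[of q] by (auto simp: haar_pw_family_def)
qed (use haar_weight_bounds[OF assms] in \<open>auto simp: haar_pw_family_def partition_on_def\<close>)

text \<open>Here \<open>q = p / (p - 2)\<close> is the exponent dual to \<open>p / 2\<close>.\<close>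

lemma pw_norm_haar_lower:
  assumes p: "2 < p" and q: "q = p / (p - 2)"
    and "0 \<le> B" and B: "pw_norm p (haar_pw_family q) a \<le> ennreal B"
  shows "(LINT x|unit_leb. haar_square a m x powr (p / 2)) \<le> 2 powr (p / 2) * B powr p"
proof -
  have r: "1 < p / 2" "q = (p / 2) / (p / 2 - 1)" "1 < q" using p by (auto simp: q field_simps)
  obtain g where g: "dual_density q g"
    "(LINT x|unit_leb. haar_square a m x powr (p / 2)) \<le> (2 * (LINT x|unit_leb. g x * haar_square a m x)) powr (p / 2)"
    using dual_density_norming[OF r(1,2) simple_function_haar_square haar_square_nonneg] by metis
  let ?S = "LINT x|unit_leb. g x * haar_square a m x"
  have S: "?S = (\<Sum>j<m. (a j)\<^sup>2 * (haar_weight g j)\<^sup>2)" by (rule sum_haar_weight[OF r(3) g(1), symmetric])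
  then have S0: "0 \<le> ?S" by (simp add: sum_nonneg)
  have "ennreal (sqrt ?S) \<le> pw_norm1 p {UNIV} (haar_weight g) a"
    unfolding S using p by (intro pw_norm1_single_block_lower) auto
  also have "\<dots> \<le> pw_norm p (haar_pw_family q) a"
    unfolding pw_norm_def haar_pw_family_def
    by (rule SUP_upper2[of "({UNIV}, haar_weight g)"]) (use g in auto)
  also note B
  finally have "sqrt ?S \<le> B" using \<open>0 \<le> B\<close> by simp
  then have "?S \<le> B\<^sup>2" by (rule sqrt_le_D)
  then have "(2 * ?S) powr (p / 2) \<le> (2 * B\<^sup>2) powr (p / 2)" using S0 p by (intro powr_mono2) auto
  also have "\<dots> = 2 powr (p / 2) * B powr p"
    using \<open>0 \<le> B\<close> powr_powr[of B 2 "p / 2"] by (simp add: powr_mult)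
  finally show ?thesis using g(2) by linarith
qed

lemma pw_norm_haar_upper:
  assumes p: "2 < p" and q: "q = p / (p - 2)" and "0 \<le> D"
    and le: "\<And>m. (LINT x|unit_leb. haar_square a m x powr (p / 2)) \<le> D powr p"
  shows "pw_norm p (haar_pw_family q) a \<le> ennreal D"
proof -
  have r: "1 < p / 2" "q = (p / 2) / (p / 2 - 1)" "1 < q" using p by (auto simp: q field_simps)
  have D: "(D\<^sup>2) powr (p / 2) = D powr p" using \<open>0 \<le> D\<close> powr_powr[of D 2 "p / 2"] by simp
  have "pw_norm1 p {UNIV} (haar_weight g) a \<le> ennreal D" if g: "dual_density q g" for g
  proof (rule pw_norm1_single_block_upper)
    fix m
    show "(\<Sum>j<m. (a j)\<^sup>2 * (haar_weight g j)\<^sup>2) \<le> D\<^sup>2"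
      unfolding sum_haar_weight[OF r(3) g]
      by (rule dual_density_upper[OF r(1,2) g simple_function_haar_square haar_square_nonneg])
        (use le[of m] D in auto)
  qed (use p \<open>0 \<le> D\<close> in auto)
  then show ?thesis unfolding pw_norm_def haar_pw_family_def by (auto intro!: SUP_least)
qed

text \<open>Both inequalities hold for partial sums with constants independent of the number of terms, so they
  pass to the limit along the expansion.\<close>

theorem corollary1p2:
  fixes p :: real
  assumes "2 < p"
  shows "has_equivalent_pw_norm p (Lp p) (Lp_norm p)"
proof -
  define q where "q = p / (p - 2)"
  have q: "1 < q" using assms by (simp add: q_def)
  have p0: "0 < p" "0 \<le> p" using assms by auto
  obtain K where K: "1 \<le> K"
    "\<And>a m. (LINT x|unit_leb. haar_square a m x powr (p / 2)) \<le> K * modular p (haar_sum a m)"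
    "\<And>a m. modular p (haar_sum a m) \<le> K * (LINT x|unit_leb. haar_square a m x powr (p / 2))"
    using haar_square_function_equivalence[OF assms] unfolding modular_def by metis
  define C where "C = (2 powr p * K) powr (1 / p)"
  define L where "L = (2 powr p * (K * 2 powr (p / 2))) powr (1 / p)"
  have "1 * 1 \<le> 2 powr p * K"
    using K(1) p0 by (intro mult_mono) (auto intro: ge_one_powr_ge_zero)
  then have C1: "1 \<le> C" unfolding C_def using p0 by (intro ge_one_powr_ge_zero) auto
  have "1 * (1 * 1) \<le> 2 powr p * (K * 2 powr (p / 2))"
    using K(1) p0 by (intro mult_mono) (auto intro: ge_one_powr_ge_zero)
  then have L1: "1 \<le> L" unfolding L_def using p0 by (intro ge_one_powr_ge_zero) auto
  have equiv: "ennreal (1 / L * Lp_norm p u) \<le> pw_norm p (haar_pw_family q) a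
      \<and> pw_norm p (haar_pw_family q) a \<le> ennreal (C * Lp_norm p u)"
    if "u \<in> Lp p" and ex: "expansion (Lp_norm p) haar_class a u" for u a
  proof -
    obtain f where f: "p_integrable p f" "u = abs_mclass f" using \<open>u \<in> Lp p\<close> by (rule Lp_representative)
    let ?r = "\<lambda>m. modular p (\<lambda>x. f x - haar_sum a m x)"
    have lim: "?r \<longlonglongrightarrow> 0"
      using ex f p0 by (simp add: expansion_haar_class p_integrable_def)
    have N: "Lp_norm p u = modular p f powr (1 / p)"
      using f by (simp add: Lp_norm_abs_mclass p_integrable_def)
    let ?S = "\<lambda>m. LINT x|unit_leb. haar_square a m x powr (p / 2)"
    have "?S m \<le> 2 powr p * K * modular p f" for m
    proof -
      have "?S m \<le> 2 powr p * K * (modular p f + ?r M)" if "m \<le> M" for M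
      proof -
        have "?S m \<le> ?S M"
          using p0 that integrable_haar_pair[of "\<lambda>f s. s powr (p / 2)"]
          by (intro integral_mono powr_mono2 haar_square_mono haar_square_nonneg) auto
        also have "\<dots> \<le> K * modular p (haar_sum a M)" by (rule K)
        also have "\<dots> \<le> K * (2 powr p * (modular p f + ?r M))"
          using modular_triangle[OF p0(2) p_integrable_haar_sum f(1), of a M] K(1)
          by (intro mult_left_mono) (auto simp: modular_minus_commute[of p f])
        finally show ?thesis by (simp add: mult_ac)
      qed
      then have ev: "\<forall>\<^sub>F M in sequentially. ?S m \<le> 2 powr p * K * (modular p f + ?r M)"
        by (auto simp: eventually_sequentially)
      have "(\<lambda>M. 2 powr p * K * (modular p f + ?r M)) \<longlonglongrightarrow> 2 powr p * K * (modular p f + 0)"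
        by (intro tendsto_intros lim)
      then have "?S m \<le> 2 powr p * K * (modular p f + 0)"
        using ev by (rule tendsto_lowerbound) simp
      then show ?thesis by simp
    qed
    moreover have "(C * Lp_norm p u) powr p = 2 powr p * K * modular p f"
      using p0 K(1) by (simp add: N C_def powr_mult powr_powr modular_nonneg)
    ultimately have upper: "pw_norm p (haar_pw_family q) a \<le> ennreal (C * Lp_norm p u)"
      using C1 by (intro pw_norm_haar_upper[OF assms q_def]) (auto simp: N)
    define B where "B = enn2real (pw_norm p (haar_pw_family q) a)"
    have B: "pw_norm p (haar_pw_family q) a = ennreal B"
      using le_less_trans[OF upper ennreal_less_top] by (simp add: B_def)
    have B0: "0 \<le> B" by (simp add: B_def)
    have "modular p f \<le> 2 powr p * (K * (2 powr (p / 2) * B powr p) + ?r m)" for m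
    proof -
      have "?S m \<le> 2 powr (p / 2) * B powr p" by (rule pw_norm_haar_lower[OF assms q_def B0]) (simp add: B)
      then have "modular p (haar_sum a m) \<le> K * (2 powr (p / 2) * B powr p)"
        using K(1) by (intro order_trans[OF K(3)] mult_left_mono) auto
      then show ?thesis
        by (intro order_trans[OF modular_triangle[OF p0(2) f(1) p_integrable_haar_sum, of a m]] mult_left_mono add_right_mono) auto
    qed
    then have ev: "\<forall>\<^sub>F m in sequentially. modular p f \<le> 2 powr p * (K * (2 powr (p / 2) * B powr p) + ?r m)"
      by (intro always_eventually allI)
    have "(\<lambda>m. 2 powr p * (K * (2 powr (p / 2) * B powr p) + ?r m))
        \<longlonglongrightarrow> 2 powr p * (K * (2 powr (p / 2) * B powr p) + 0)"
      by (intro tendsto_intros lim)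
    then have "modular p f \<le> 2 powr p * (K * (2 powr (p / 2) * B powr p) + 0)"
      using ev by (rule tendsto_lowerbound) simp
    then have "modular p f \<le> 2 powr p * (K * 2 powr (p / 2)) * B powr p" by (simp add: mult_ac)
    then have "modular p f powr (1 / p) \<le> (2 powr p * (K * 2 powr (p / 2)) * B powr p) powr (1 / p)"
      using p0 by (intro powr_mono2) (auto simp: modular_nonneg)
    also have "\<dots> = L * B" using p0 B0 by (simp add: L_def powr_mult[of _ "B powr p"] powr_powr)
    finally have "1 / L * Lp_norm p u \<le> B" using L1 by (simp add: N field_simps)
    then show ?thesis using upper by (simp add: B ennreal_leI)
  qed
  show ?thesis
    unfolding has_equivalent_pw_norm_def
  proof (intro exI conjI ballI allI impI)
    show "schauder_basis (Lp p) (Lp_norm p) haar_class" by (rule schauder_basis_haar[OF assms])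
    show "pw_family (haar_pw_family q)" by (rule pw_family_haar[OF q])
    show "0 < 1 / L" "1 / L \<le> C" using L1 C1 by (auto intro: order_trans[of _ 1])
    fix u a assume "u \<in> Lp p" "expansion (Lp_norm p) haar_class a u"
    from equiv[OF this] show "ennreal (1 / L * Lp_norm p u) \<le> pw_norm p (haar_pw_family q) a"
      "pw_norm p (haar_pw_family q) a \<le> ennreal (C * Lp_norm p u)" by auto
  qed
qed

end
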